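(* For a fixed starting point $\mathbf{w}=(a,b,c)\in\mathcal{T}_\ell\subseteq\mathbb{R}_+^3$, the left earthquake deformation about $\alpha$ in triangle lengths is given by the map $$E_\alpha^{\ell}(\mathbf{w}):\mathbb{R}\to\mathbb{R}_+^3,\qquad r\mapsto\begin{pmatrix}a\\ b_\alpha(r)\\ b_\alpha(r-1)\end{pmatrix},$$ where $b_\alpha:\mathbb{R}\to\mathbb{R}_+$ is given by $$b_\alpha(r)=\cosh^{-1}\left(\cosh(b)\cosh(ra)-\big(\cosh(c)-\cosh(a)\cosh(b)\big)\frac{\sinh(ra)}{\sinh(a)}\right).$$ Moreover, $E_\alpha^{\ell}(\mathbf{w})(n)=\bar T_\alpha^n(\mathbf{w})$ for all $n\in\mathbb{Z}$.
   Context: $\mathbb{R}_+$ denotes the positive reals. $S_{1,1}$ is the once-punctured torus, with $\pi_1(S_{1,1})$ free on the simple closed curves $\alpha,\beta$ (meridian and longitude). The Teichm\"uller space $\mathcal{T}(S_{1,1})$ of marked complete finite-area hyperbolic structures is identified with $\mathcal{T}_{\mathrm{tr}}=\{(x,y,z)\in\mathbb{R}_+^3: x^2+y^2+z^2-xyz-2=-2\}$ via trace coordinates $(x,y,z)=(\mathrm{tr}\,\rho(\alpha),\mathrm{tr}\,\rho(\beta),\mathrm{tr}\,\rho(\alpha\beta))$ of the holonomy $\rho$ (lifted to $\mathrm{SL}_2(\mathbb{R})$ with positive traces). Triangle lengths are the half-lengths of the geodesic representatives: $(a,b,c)=\left(\tfrac{\ell(\alpha)}2,\tfrac{\ell(\beta)}2,\tfrac{\ell(\alpha\beta)}2\right)=\left(\cosh^{-1}\tfrac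 x2,\cosh^{-1}\tfrac y2,\cosh^{-1}\tfrac z2\right)$. They identify $\mathcal{T}(S_{1,1})$ with $\mathcal{T}_\ell=\{(a,b,c)\in\mathbb{R}_+^3:\cosh^2a+\cosh^2b+\cosh^2c=2\cosh a\cosh b\cosh c\}$. The left Dehn twist $T_\alpha$ ($\alpha\mapsto\alpha$, $\beta\mapsto\beta\alpha^{-1}$) acts in trace coordinates by $\tilde T_\alpha(x,y,z)=(x,xy-z,y)$; $\bar T_\alpha$ denotes the same map written in triangle lengths. The left earthquake deformation about $\alpha$ is the path in Teichm\"uller space obtained from a hyperbolic structure by cutting the surface along the geodesic $\alpha$, twisting to the left along $\alpha$ and regluing (the Fenchel–Nielsen twist deformation about $\alpha$). The parameter $r\in\mathbb{R}$ is the relative length twisted: time $r$ corresponds to twisting by distance $r\,\ell(\alpha)=2ra$, so that $r=1$ is a twist by the full length of $\alpha$; negative $r$ means twisting in the opposite direction. Orientations are chosen so that the time-$1$ left earthquake is the left Dehn twist $\bar T_\alpha$. *)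

theory Defs
  imports "HOL-Analysis.Analysis"
begin

section \<open>Isometries of the upper half-plane\<close>

type_synonym mat2 = "real^2^2"

definition SL2 :: "mat2 set" where
  "SL2 = {M. det M = 1}"

definition upper_half :: "complex set" where
  "upper_half = {z. 0 < Im z}"

definition moebius :: "mat2 \<Rightarrow> complex \<Rightarrow> complex" where
  "moebius M z = (of_real (M$1$1) * z + of_real (M$1$2)) / (of_real (M$2$1) * z + of_real (M$2$2))"

definition dilation :: "real \<Rightarrow> mat2" where
  "dilation d = vector [vector [exp (d/2), 0], vector [0, exp (- d/2)]]"

text \<open>
  A matrix \<open>g\<close> in \<^const>\<open>SL2\<close> encodes an oriented geodesic of the upper half-plane: the image under
  \<open>g\<close> of the imaginary axis, oriented from 0 to infinity.  Every oriented geodesic is of this form.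
  Since \<open>g\<close> is an orientation-preserving isometry, the left side of this oriented geodesic is the
  image of the quadrant of points with negative real part.  Likewise \<open>translation g d\<close> is the
  hyperbolic isometry that moves every point of the geodesic forward by the signed hyperbolic
  distance \<open>d\<close>: it is conjugate by \<open>g\<close> to the map taking \<open>z\<close> to \<open>exp d * z\<close>, and the distance from
  \<open>\<i>\<close> to \<open>exp d * \<i>\<close> is \<open>\<bar>d\<bar>\<close>.
\<close>

definition geodesic_line :: "mat2 \<Rightarrow> complex set" where
  "geodesic_line g = moebius g ` {z \<in> upper_half. Re z = 0}"

definition left_side :: "mat2 \<Rightarrow> complex set" where
  "left_side g = moebius g ` {z \<in> upper_half. Re z < 0}"

definition translation :: "mat2 \<Rightarrow> real \<Rightarrow> mat2" where
  "translation g d = g ** dilation d ** matrix_inv g"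

definition parabolic :: "mat2 \<Rightarrow> bool" where
  "parabolic M \<longleftrightarrow> \<bar>trace M\<bar> = 2 \<and> M \<noteq> mat 1 \<and> M \<noteq> - mat 1"


section \<open>Words in the free group on alpha and beta, and their holonomy\<close>

datatype curve = Alpha | Beta

text \<open>In a letter the Boolean \<^const>\<open>True\<close> marks the inverse of the generator.\<close>

type_synonym letter = "curve \<times> bool"

fun reduced_word :: "letter list \<Rightarrow> bool" where
  "reduced_word (x # y # w) \<longleftrightarrow> \<not> (fst x = fst y \<and> snd x \<noteq> snd y) \<and> reduced_word (y # w)"
| "reduced_word w \<longleftrightarrow> True"

text \<open>
  As the fundamental group is free on alpha and beta, a representation \<open>\<rho>\<close> into \<^const>\<open>SL2\<close> is
  given by the pair of its values on these two generators.
\<close>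

type_synonym rep = "mat2 \<times> mat2"

fun letter_value :: "rep \<Rightarrow> letter \<Rightarrow> mat2" where
  "letter_value \<rho> (Alpha, i) = (if i then matrix_inv (fst \<rho>) else fst \<rho>)"
| "letter_value \<rho> (Beta, i) = (if i then matrix_inv (snd \<rho>) else snd \<rho>)"

fun holonomy :: "rep \<Rightarrow> letter list \<Rightarrow> mat2" where
  "holonomy \<rho> [] = mat 1"
| "holonomy \<rho> (x # w) = letter_value \<rho> x ** holonomy \<rho> w"

abbreviation commutator_word :: "letter list" where
  "commutator_word \<equiv> [(Alpha, False), (Beta, False), (Alpha, True), (Beta, True)]"


section \<open>Teichmueller space of the once-punctured torus\<close>

text \<open>Since the two oriented geodesics \<open>g\<close> carrying the axis of \<open>M\<close> are opposite to each other, the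
  condition \<open>0 < d\<close> selects the one that points in the direction in which \<open>M\<close> translates.\<close>

definition directed_axis :: "mat2 \<Rightarrow> mat2 \<Rightarrow> bool" where
  "directed_axis M g \<longleftrightarrow> g \<in> SL2 \<and> (\<exists>d>0. M = translation g d)"

text \<open>
  The orientation of the marking: beta crosses alpha from right to left, that is, \<open>\<rho>(\<beta>)\<close> moves the
  directed axis of \<open>\<rho>(\<alpha>)\<close> to its own left.  This is the choice of orientations for which the left
  Dehn twist about alpha takes beta to \<open>\<beta>\<alpha>\<^sup>-\<^sup>1\<close>; for the opposite choice a left twist
  takes beta to \<open>\<beta>\<alpha>\<close>.
\<close>

definition positively_marked :: "rep \<Rightarrow> bool" where
  "positively_marked \<rho> \<longleftrightarrow>
    (\<exists>g. directed_axis (fst \<rho>) g \<and> moebius (snd \<rho>) ` geodesic_line g \<subseteq> left_side g)"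

text \<open>
  Holonomies of marked complete hyperbolic structures of finite area, lifted to \<^const>\<open>SL2\<close> with
  positive traces.  They are the discrete representations that are faithful modulo \<open>\<plusminus>1\<close> and send the
  commutator, which is the loop around the puncture, to a parabolic element (finite area).  The
  closed curves alpha, beta and their product are not peripheral, so their holonomies are hyperbolic
  and the positive traces exceed 2.  Teichmueller space is the quotient of this set by conjugation;
  trace coordinates and triangle lengths depend only on the conjugacy class.
\<close>

definition teich :: "rep set" where
  "teich = {\<rho>. fst \<rho> \<in> SL2 \<and> snd \<rho> \<in> SL2 \<and>
     discrete (range (holonomy \<rho>)) \<and>
     (\<forall>w. reduced_word w \<and> w \<noteq> [] \<longrightarrow> holonomy \<rho> w \<noteq> mat 1 \<and> holonomy \<rho> w \<noteq> - mat 1) \<and>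
     parabolic (holonomy \<rho> commutator_word) \<and>
     2 < trace (fst \<rho>) \<and> 2 < trace (snd \<rho>) \<and> 2 < trace (fst \<rho> ** snd \<rho>) \<and>
     positively_marked \<rho>}"

definition trace_coords :: "rep \<Rightarrow> real \<times> real \<times> real" where
  "trace_coords \<rho> = (trace (fst \<rho>), trace (snd \<rho>), trace (fst \<rho> ** snd \<rho>))"

definition lengths_of_traces :: "real \<times> real \<times> real \<Rightarrow> real \<times> real \<times> real" where
  "lengths_of_traces = (\<lambda>(x, y, z). (arcosh (x/2), arcosh (y/2), arcosh (z/2)))"

definition traces_of_lengths :: "real \<times> real \<times> real \<Rightarrow> real \<times> real \<times> real" where
  "traces_of_lengths = (\<lambda>(a, b, c). (2 * cosh a, 2 * cosh b, 2 * cosh c))"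

definition triangle_lengths :: "rep \<Rightarrow> real \<times> real \<times> real" where
  "triangle_lengths \<rho> = lengths_of_traces (trace_coords \<rho>)"

definition T_len :: "(real \<times> real \<times> real) set" where
  "T_len = {(a, b, c). 0 < a \<and> 0 < b \<and> 0 < c \<and>
     (cosh a)\<^sup>2 + (cosh b)\<^sup>2 + (cosh c)\<^sup>2 = 2 * cosh a * cosh b * cosh c}"


section \<open>The left earthquake about alpha\<close>

text \<open>The geodesic in the class of alpha is the quotient of the axis of \<open>\<rho>(\<alpha>)\<close>; its length is twice
  the first triangle length.\<close>

definition alpha_length :: "rep \<Rightarrow> real" where
  "alpha_length \<rho> = 2 * fst (triangle_lengths \<rho>)"

text \<open>
  Cutting, twisting and regluing is described on the universal cover.  The lifts of the geodesic
  alpha are the translates \<open>\<rho>(v)L\<close> of the axis \<open>L\<close> of \<open>\<rho>(\<alpha>)\<close>, and they cut the half-plane into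
  pieces, which are the universal covers of the cut surface.  Let \<open>P\<close> be the piece that has both
  \<open>L\<close> and \<open>\<rho>(\<beta>)L\<close> on its boundary.  The pieces are the translates \<open>\<rho>(v)P\<close>; the stabiliser of
  \<open>P\<close> is the fundamental group of the cut surface, which is generated by alpha and
  \<open>\<beta>\<alpha>\<beta>\<^sup>-\<^sup>1\<close>; and \<open>\<rho>(v)L\<close> separates the two pieces \<open>\<rho>(v)P\<close> and
  \<open>\<rho>(v\<beta>\<^sup>-\<^sup>1)P\<close>.

  An earthquake applies to each piece \<open>\<rho>(v)P\<close> an isometry \<open>\<Phi> v\<close>.  The oriented geodesic \<open>g\<close> below
  is \<open>L\<close> with \<open>P\<close> on its left.  An observer in \<open>\<rho>(v)P\<close> facing \<open>\<rho>(v)L\<close> has the forward direction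
  of \<open>\<rho>(v)g\<close> on the left hand, so, by the condition on \<open>\<Phi> (v @ [(Beta, True)])\<close>, the piece behind
  \<open>\<rho>(v)L\<close> is displaced to the left by the distance \<open>d\<close> relative to \<open>\<rho>(v)P\<close>.  The last condition
  says that the pieces, so displaced, form the universal cover of a structure with holonomy \<open>\<sigma>\<close>
  and that the earthquake is compatible with the markings.
\<close>

definition left_twist :: "real \<Rightarrow> rep \<Rightarrow> rep \<Rightarrow> bool" where
  "left_twist d \<rho> \<sigma> \<longleftrightarrow>
    (\<exists>g (\<Phi> :: letter list \<Rightarrow> mat2).
       g \<in> SL2 \<and> (\<exists>t. fst \<rho> = translation g t) \<and>
       moebius (snd \<rho>) ` geodesic_line g \<subseteq> left_side g \<and>
       (\<forall>v. \<Phi> v \<in> SL2) \<and>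
       (\<forall>v. \<Phi> (v @ [(Alpha, False)]) = \<Phi> v) \<and>
       (\<forall>v. \<Phi> (v @ [(Beta, False), (Alpha, False), (Beta, True)]) = \<Phi> v) \<and>
       (\<forall>v. \<Phi> (v @ [(Beta, True)]) = \<Phi> v ** translation (holonomy \<rho> v ** g) d) \<and>
       (\<forall>u v. holonomy \<sigma> u ** \<Phi> v = \<Phi> (u @ v) ** holonomy \<rho> u))"

definition left_earthquake :: "real \<Rightarrow> rep \<Rightarrow> rep \<Rightarrow> bool" where
  "left_earthquake r \<rho> \<sigma> \<longleftrightarrow> left_twist (r * alpha_length \<rho>) \<rho> \<sigma>"

definition cosh_b_alpha :: "real \<times> real \<times> real \<Rightarrow> real \<Rightarrow> real" where
  "cosh_b_alpha = (\<lambda>(a, b, c) r.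
     cosh b * cosh (r * a) - (cosh c - cosh a * cosh b) * (sinh (r * a) / sinh a))"

definition b_alpha :: "real \<times> real \<times> real \<Rightarrow> real \<Rightarrow> real" where
  "b_alpha w r = arcosh (cosh_b_alpha w r)"

definition E_alpha :: "real \<times> real \<times> real \<Rightarrow> real \<Rightarrow> real \<times> real \<times> real" where
  "E_alpha w r = (fst w, b_alpha w r, b_alpha w (r - 1))"


section \<open>The left Dehn twist about alpha\<close>

definition dehn_trace :: "real \<times> real \<times> real \<Rightarrow> real \<times> real \<times> real" where
  "dehn_trace = (\<lambda>(x, y, z). (x, x * y - z, y))"

definition dehn_len :: "real \<times> real \<times> real \<Rightarrow> real \<times> real \<times> real" where
  "dehn_len w = lengths_of_traces (dehn_trace (traces_of_lengths w))"

text \<open>Integer powers of the Dehn twist as a bijection of \<^const>\<open>T_len\<close>; see \<open>bij_betw_dehn_len\<close>.\<close>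

definition dehn_power :: "int \<Rightarrow> real \<times> real \<times> real \<Rightarrow> real \<times> real \<times> real" where
  "dehn_power n = (if 0 \<le> n then dehn_len ^^ nat n else inv_into T_len dehn_len ^^ nat (- n))"

lemma markov_gt_1:
  fixes X Y Z :: real
  assumes pos: "0 < X" "0 < Y" "0 < Z" and eq: "X\<^sup>2 + Y\<^sup>2 + Z\<^sup>2 = 2 * X * Y * Z"
  shows "1 < X"
proof -
  have "0 \<le> (Y - Z)\<^sup>2" by simp
  then have "2 * (Y * Z) \<le> Y\<^sup>2 + Z\<^sup>2" by (simp add: power2_diff)
  moreover have "0 < X\<^sup>2" using pos by simp
  moreover have "X\<^sup>2 + Y\<^sup>2 + Z\<^sup>2 = 2 * (X * (Y * Z))" using eq by (simp add: mult.assoc)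
  ultimately have "1 * (Y * Z) < X * (Y * Z)" by linarith
  moreover have "0 < Y * Z" using pos by simp
  ultimately show ?thesis by (simp only: mult_less_cancel_right_pos)
qed

lemma dehn_root:
  fixes X Y Z :: real
  assumes pos: "0 < X" "0 < Y" "0 < Z" and eq: "X\<^sup>2 + Y\<^sup>2 + Z\<^sup>2 = 2 * X * Y * Z"
  shows "1 < 2 * X * Y - Z" "X\<^sup>2 + (2 * X * Y - Z)\<^sup>2 + Y\<^sup>2 = 2 * X * (2 * X * Y - Z) * Y"
proof -
  show eq': "X\<^sup>2 + (2 * X * Y - Z)\<^sup>2 + Y\<^sup>2 = 2 * X * (2 * X * Y - Z) * Y"
    using eq by (simp add: power2_eq_square algebra_simps)
  have "Z * (2 * X * Y - Z) = X\<^sup>2 + Y\<^sup>2"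
    using eq by (simp add: power2_eq_square algebra_simps)
  then have "0 < Z * (2 * X * Y - Z)" using pos by (simp add: add_pos_pos)
  then have "0 < 2 * X * Y - Z" using pos(3) by (simp add: zero_less_mult_iff)
  then show "1 < 2 * X * Y - Z"
    by (rule markov_gt_1[of _ X Y]) (use pos eq' in \<open>simp_all add: algebra_simps\<close>)
qed

lemma bij_betw_dehn_len: "bij_betw dehn_len T_len T_len"
proof -
  define S :: "real \<times> real \<times> real \<Rightarrow> real \<times> real \<times> real"
    where "S = (\<lambda>(a, b, c). (a, c, arcosh (2 * cosh a * cosh c - cosh b)))"
  have T: "dehn_len (a, b, c) = (a, arcosh (2 * cosh a * cosh b - cosh c), b)"
    if "(a, b, c) \<in> T_len" for a b c
    using that by (simp add: T_len_def dehn_len_def lengths_of_traces_def dehn_trace_def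
        traces_of_lengths_def arcosh_cosh_real diff_divide_distrib mult.assoc)
  have T1: "1 < 2 * cosh a * cosh b - cosh c" "dehn_len (a, b, c) \<in> T_len"
    if "(a, b, c) \<in> T_len" for a b c
    using dehn_root[of "cosh a" "cosh b" "cosh c"] that T[OF that]
    by (auto simp: T_len_def)
  have S1: "1 < 2 * cosh a * cosh c - cosh b" "S (a, b, c) \<in> T_len"
    if "(a, b, c) \<in> T_len" for a b c
    using dehn_root[of "cosh a" "cosh c" "cosh b"] that
    by (auto simp: T_len_def S_def algebra_simps)
  have ST: "S (dehn_len w) = w" if "w \<in> T_len" for w
  proof -
    obtain a b c where w: "w = (a, b, c)" by (cases w)
    show ?thesis using that T1[of a b c] T[of a b c]
      by (simp add: w S_def arcosh_cosh_real T_len_def)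
  qed
  have TS: "dehn_len (S w) = w" if "w \<in> T_len" for w
  proof -
    obtain a b c where w: "w = (a, b, c)" by (cases w)
    have "dehn_len (S w) = (a, arcosh (2 * cosh a * cosh c - (2 * cosh a * cosh c - cosh b)), c)"
      using S1[of a b c] that T[of a c "arcosh (2 * cosh a * cosh c - cosh b)"]
      by (simp add: w S_def)
    then show ?thesis using that by (simp add: w arcosh_cosh_real T_len_def)
  qed
  show ?thesis
    by (rule bij_betw_byWitness[where f' = S]) (use ST TS T1 S1 in auto)
qed

end

theory Submission
  imports Defs
begin

text \<open>
  Put the axis of \<open>\<rho>(\<alpha>)\<close> on the imaginary axis.  Then \<open>\<rho>(\<alpha>)\<close> is the diagonal matrix with entries
  \<open>exp a\<close> and \<open>exp (- a)\<close>, and the diagonal entries \<open>p\<close> and \<open>u\<close> of \<open>\<rho>(\<beta>)\<close> are determined by the other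
  two traces: \<open>p + u = 2 cosh b\<close> and \<open>exp a * p + exp (- a) * u = 2 cosh c\<close>.  The conditions that
  define the twist force the new holonomy to be, up to conjugation, the one that keeps \<open>\<rho>(\<alpha>)\<close> and
  replaces \<open>\<rho>(\<beta>)\<close> by \<open>\<rho>(\<beta>) T\<close>, where \<open>T\<close> is the translation by \<open>- 2ra\<close> along the axis
  (\<open>left_twist_similar\<close>, \<open>left_twist_exists\<close>).  This multiplies \<open>p\<close> by \<open>exp (- ra)\<close> and \<open>u\<close> by
  \<open>exp (ra)\<close>, so the new trace of beta is \<open>p exp (- ra) + u exp (ra)\<close>; by the two equations for \<open>p\<close>
  and \<open>u\<close> this is the closed formula \<open>2 cosh_b_alpha w r\<close>.  The product \<open>\<alpha>\<beta>\<close> gets one additional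
  factor \<open>exp a\<close>, which shifts \<open>r\<close> to \<open>r - 1\<close>.

  The Markov equation \<open>x\<^sup>2 + y\<^sup>2 + z\<^sup>2 = xyz\<close> turns into \<open>p u (sinh a)\<^sup>2 = (cosh a)\<^sup>2\<close>, an equation that
  is visibly preserved by the deformation and that gives \<open>p u > 1\<close>, whence
  \<open>1 < cosh_b_alpha w r\<close> by the inequality of the means.  It also fixes the signs of all four entries
  of \<open>\<rho>(\<beta>)\<close> once the orientation of the marking is given (\<open>frame_signs\<close>); these signs distinguish
  the two directions of the axis, so a left twist cannot be confused with a right twist
  (\<open>marking_frame_length_unique\<close>).

  What remains is that every pair with Markov traces generates a discrete free group
  (\<open>markov_pair_discrete_free\<close>); this yields both the existence of a hyperbolic structure with given
  lengths and the fact that earthquakes stay in Teichmueller space.  Such a pair is conjugate to an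
  explicit pair whose commutator fixes infinity (\<open>ex_cusp_normal_form\<close>), and for the latter the
  sides of an ideal quadrilateral are paired, so that ping-pong applies.

  For integers the statement follows because \<open>p exp (- ra) + u exp (ra)\<close> satisfies the recursion
  \<open>f (r + 1) = 2 cosh a * f r - f (r - 1)\<close>, which is the Dehn twist in trace coordinates.
\<close>

section \<open>Two-by-two matrices and Moebius transformations\<close>

definition mk_mat2 :: "real \<Rightarrow> real \<Rightarrow> real \<Rightarrow> real \<Rightarrow> mat2" where
  "mk_mat2 a b c d = vector [vector [a, b], vector [c, d]]"

lemma mk_mat2_nth [simp]:
  "mk_mat2 a b c d $ 1 $ 1 = a" "mk_mat2 a b c d $ 1 $ 2 = b"
  "mk_mat2 a b c d $ 2 $ 1 = c" "mk_mat2 a b c d $ 2 $ 2 = d"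
  by (simp_all add: mk_mat2_def)

lemma dilation_nth [simp]:
  "dilation d $ 1 $ 1 = exp (d/2)" "dilation d $ 1 $ 2 = 0"
  "dilation d $ 2 $ 1 = 0" "dilation d $ 2 $ 2 = exp (- d/2)"
  by (simp_all add: dilation_def)

lemma mat1_nth [simp]:
  "(mat 1 :: mat2) $ 1 $ 1 = 1" "(mat 1 :: mat2) $ 1 $ 2 = 0"
  "(mat 1 :: mat2) $ 2 $ 1 = 0" "(mat 1 :: mat2) $ 2 $ 2 = 1"
  by (simp_all add: mat_def)

lemma mat2_eq_iff:
  "M = N \<longleftrightarrow> M$1$1 = N$1$1 \<and> M$1$2 = N$1$2 \<and> M$2$1 = N$2$1 \<and> M$2$2 = (N::mat2)$2$2"
  by (auto simp: vec_eq_iff forall_2)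

lemma mat2_mult_nth: "(M ** N) $ i $ j = M$i$1 * N$1$j + M$i$2 * (N::mat2)$2$j"
  by (simp add: matrix_matrix_mult_def sum_2)

lemma trace_mat2: "trace M = M$1$1 + (M::mat2)$2$2"
  by (simp add: trace_def sum_2)

lemma SL2_iff: "M \<in> SL2 \<longleftrightarrow> M$1$1 * M$2$2 - M$1$2 * M$2$1 = 1"
  by (simp add: SL2_def det_2)

lemma matrix_inv_eqI:
  fixes M N :: mat2
  assumes "M ** N = mat 1"
  shows "matrix_inv M = N"
proof -
  have "N ** M = mat 1" using assms matrix_left_right_inverse by blast
  then have "invertible M" using assms unfolding invertible_def by blast
  then have "matrix_inv M ** M = mat 1"
    unfolding matrix_inv_def invertible_def by (metis (mono_tags, lifting) someI_ex)
  then show ?thesis using assms by (metis matrix_mul_assoc matrix_mul_lid matrix_mul_rid)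
qed

lemma SL2_adjugate:
  assumes "M \<in> SL2"
  shows "M ** mk_mat2 (M$2$2) (- M$1$2) (- M$2$1) (M$1$1) = mat 1"
  using assms by (simp add: mat2_eq_iff mat2_mult_nth SL2_iff algebra_simps)

lemma matrix_inv_SL2_nth:
  assumes "M \<in> SL2"
  shows "matrix_inv M $ 1 $ 1 = M$2$2" "matrix_inv M $ 1 $ 2 = - M$1$2"
    "matrix_inv M $ 2 $ 1 = - M$2$1" "matrix_inv M $ 2 $ 2 = M$1$1"
  by (simp_all add: matrix_inv_eqI[OF SL2_adjugate[OF assms]])

lemma SL2_inv_mult [simp]:
  assumes "M \<in> SL2"
  shows "M ** matrix_inv M = mat 1" "matrix_inv M ** M = mat 1"
  using SL2_adjugate[OF assms] matrix_inv_eqI matrix_left_right_inverse by metis+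

lemma SL2_inv_cancel [simp]:
  assumes "M \<in> SL2"
  shows "M ** (matrix_inv M ** N) = N" "matrix_inv M ** (M ** N) = N"
  using assms by (simp_all add: matrix_mul_assoc)

lemma SL2_mult [simp, intro]: "M \<in> SL2 \<Longrightarrow> N \<in> SL2 \<Longrightarrow> M ** N \<in> SL2"
  by (simp add: SL2_def det_mul)

lemma SL2_one [simp, intro]: "mat 1 \<in> SL2"
  by (simp add: SL2_iff)

lemma SL2_inv [simp, intro]: "M \<in> SL2 \<Longrightarrow> matrix_inv M \<in> SL2"
  by (simp add: SL2_iff[of "matrix_inv M"] matrix_inv_SL2_nth) (simp add: SL2_iff mult.commute)

lemma SL2_dilation [simp, intro]: "dilation d \<in> SL2"
  by (simp add: SL2_iff flip: exp_add)

lemma matrix_inv_mult_SL2: "M \<in> SL2 \<Longrightarrow> N \<in> SL2 \<Longrightarrow> matrix_inv (M ** N) = matrix_inv N ** matrix_inv M"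
  by (rule matrix_inv_eqI) (simp flip: matrix_mul_assoc)

lemma matrix_inv_inv_SL2 [simp]: "M \<in> SL2 \<Longrightarrow> matrix_inv (matrix_inv M) = M"
  by (rule matrix_inv_eqI) simp

lemma dilation_add: "dilation c ** dilation d = dilation (c + d)"
  by (simp add: mat2_eq_iff mat2_mult_nth exp_add[symmetric] add_divide_distrib)

lemma dilation_0 [simp]: "dilation 0 = mat 1"
  by (simp add: mat2_eq_iff)

lemma trace_similar:
  fixes M P Q :: mat2
  assumes "Q ** P = mat 1"
  shows "trace (P ** M ** Q) = trace M"
  by (metis assms matrix_mul_assoc matrix_mul_lid trace_mul_sym)

lemma SL2_denominator_nonzero:
  assumes "M \<in> SL2" "0 < Im z"
  shows "of_real (M$2$1) * z + of_real (M$2$2) \<noteq> 0"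
proof
  assume 0: "of_real (M$2$1) * z + of_real (M$2$2) = 0"
  then have "M$2$1 * Im z = 0" by (auto dest: arg_cong[of _ _ Im])
  moreover have "M$2$1 * Re z + M$2$2 = 0" using arg_cong[OF 0, of Re] by simp
  ultimately show False using assms by (auto simp: SL2_iff)
qed

lemma Im_moebius:
  assumes "M \<in> SL2" "0 < Im z"
  shows "0 < Im (moebius M z)"
proof -
  let ?d = "of_real (M$2$1) * z + of_real (M$2$2)"
  have "Im (moebius M z) = Im z / ((Re ?d)\<^sup>2 + (Im ?d)\<^sup>2)"
  proof -
    have "M$1$1 * Im z * (M$2$1 * Re z + M$2$2) - (M$1$1 * Re z + M$1$2) * (M$2$1 * Im z)
        = (M$1$1 * M$2$2 - M$1$2 * M$2$1) * Im z" by (simp add: algebra_simps)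
    then show ?thesis using assms(1) by (simp add: moebius_def Im_divide SL2_iff)
  qed
  moreover have "0 < (Re ?d)\<^sup>2 + (Im ?d)\<^sup>2"
    using SL2_denominator_nonzero[OF assms] by (simp add: complex_eq_iff sum_power2_gt_zero_iff)
  ultimately show ?thesis using assms by simp
qed

lemma moebius_mult:
  assumes "M \<in> SL2" "N \<in> SL2" "0 < Im z"
  shows "moebius (M ** N) z = moebius M (moebius N z)"
proof -
  have 1: "of_real (N$2$1) * z + of_real (N$2$2) \<noteq> 0"
    using assms SL2_denominator_nonzero by blast
  have 2: "of_real ((M**N)$2$1) * z + of_real ((M**N)$2$2) \<noteq> 0"
    using assms SL2_denominator_nonzero SL2_mult by blast
  have 3: "of_real (M$2$1) * moebius N z + of_real (M$2$2) \<noteq> 0"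
    using assms SL2_denominator_nonzero Im_moebius by blast
  show ?thesis
    using 1 2 3
    by (simp add: moebius_def mat2_mult_nth divide_simps) (simp add: algebra_simps)
qed

lemma moebius_one [simp]: "moebius (mat 1) z = z"
  by (simp add: moebius_def)


section \<open>Holonomy of words\<close>

lemma letter_value_SL2:
  assumes "fst \<rho> \<in> SL2" "snd \<rho> \<in> SL2"
  shows "letter_value \<rho> l \<in> SL2"
  using assms by (cases "(\<rho>, l)" rule: letter_value.cases) auto

lemma holonomy_SL2:
  assumes "fst \<rho> \<in> SL2" "snd \<rho> \<in> SL2"
  shows "holonomy \<rho> w \<in> SL2"
  by (induction w) (auto simp: letter_value_SL2[OF assms])

lemma holonomy_append: "holonomy \<rho> (u @ v) = holonomy \<rho> u ** holonomy \<rho> v"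
  by (induction u) (simp_all add: matrix_mul_assoc)

fun inverse_letter :: "letter \<Rightarrow> letter" where
  "inverse_letter (c, i) = (c, \<not> i)"

lemma letter_value_inverse:
  assumes "fst \<rho> \<in> SL2" "snd \<rho> \<in> SL2"
  shows "letter_value \<rho> (inverse_letter l) = matrix_inv (letter_value \<rho> l)"
  using assms by (cases "(\<rho>, l)" rule: letter_value.cases) auto

lemma matrix_inv_holonomy:
  assumes "fst \<rho> \<in> SL2" "snd \<rho> \<in> SL2"
  shows "matrix_inv (holonomy \<rho> w) = holonomy \<rho> (rev (map inverse_letter w))"
proof (induction w)
  case Nil
  show ?case by (simp add: matrix_inv_eqI)
next
  case (Cons l w)
  then show ?case
    using assms
    by (simp add: holonomy_append matrix_inv_mult_SL2 letter_value_SL2 holonomy_SL2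
        letter_value_inverse)
qed

lemma reduced_word_Cons:
  "reduced_word (l # w) \<longleftrightarrow> reduced_word w \<and> (w = [] \<or> hd w \<noteq> inverse_letter l)"
  by (cases w; cases l; cases "hd w") auto

lemma ex_reduced_word:
  assumes "fst \<rho> \<in> SL2" "snd \<rho> \<in> SL2"
  shows "\<exists>v. reduced_word v \<and> holonomy \<rho> v = holonomy \<rho> w"
proof (induction w)
  case Nil
  show ?case by (intro exI[of _ "[]"]) simp
next
  case (Cons l w)
  then obtain v where v: "reduced_word v" "holonomy \<rho> v = holonomy \<rho> w" by blast
  show ?case
  proof (cases "v \<noteq> [] \<and> hd v = inverse_letter l")
    case True
    then obtain v' where v': "v = inverse_letter l # v'" by (cases v) auto
    have "holonomy \<rho> v' = letter_value \<rho> l ** holonomy \<rho> v"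
      using assms by (simp add: v' letter_value_inverse letter_value_SL2)
    moreover have "reduced_word v'" using v(1) by (simp add: v' reduced_word_Cons)
    ultimately show ?thesis using v(2) by (intro exI[of _ v']) simp
  next
    case False
    with v show ?thesis by (intro exI[of _ "l # v"]) (auto simp: reduced_word_Cons)
  qed
qed

lemma holonomy_similar:
  fixes P Q :: mat2
  assumes "Q ** P = mat 1" "A \<in> SL2" "B \<in> SL2"
  shows "holonomy (P ** A ** Q, P ** B ** Q) w = P ** holonomy (A, B) w ** Q"
proof -
  have PQ: "P ** Q = mat 1" using assms(1) matrix_left_right_inverse by blast
  have conj_mult: "(P ** M ** Q) ** (P ** N ** Q) = P ** (M ** N) ** Q" for M N
    by (metis assms(1) matrix_mul_assoc matrix_mul_rid)
  have inv: "matrix_inv (P ** M ** Q) = P ** matrix_inv M ** Q" if "M \<in> SL2" for M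
    by (rule matrix_inv_eqI) (use that in \<open>simp add: conj_mult PQ\<close>)
  have "letter_value (P ** A ** Q, P ** B ** Q) l = P ** letter_value (A, B) l ** Q" for l
    using assms(2,3) inv by (cases "((A, B), l)" rule: letter_value.cases) auto
  then show ?thesis by (induction w) (simp_all add: conj_mult PQ)
qed


section \<open>Ping-pong on an ideal quadrilateral\<close>

text \<open>
  The pair with Markov traces \<open>x\<close>, \<open>y\<close>, \<open>z\<close>, normalised so that its commutator fixes infinity and so
  that the sides of the ideal quadrilateral with vertices infinity, \<open>- y\<^sup>2\<close>, 0 and \<open>x\<^sup>2\<close> are paired.
  As Moebius transformations these are \<open>\<tau> \<mapsto> x\<^sup>2 + z\<^sup>2 \<tau> / (\<tau> + y\<^sup>2)\<close> and
  \<open>\<tau> \<mapsto> z\<^sup>2 \<tau> / (x\<^sup>2 - \<tau>) - y\<^sup>2\<close>.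
\<close>

definition cusp_A :: "real \<Rightarrow> real \<Rightarrow> real \<Rightarrow> mat2" where
  "cusp_A x y z = mk_mat2 ((x\<^sup>2 + z\<^sup>2) / (y * z)) (x\<^sup>2 * y / z) (1 / (y * z)) (y / z)"

definition cusp_B :: "real \<Rightarrow> real \<Rightarrow> real \<Rightarrow> mat2" where
  "cusp_B x y z = mk_mat2 ((y\<^sup>2 + z\<^sup>2) / (x * z)) (- (x * y\<^sup>2 / z)) (- (1 / (x * z))) (x / z)"

text \<open>
  Each letter \<open>l\<close> owns one side of the quadrilateral; \<open>side x y l\<close> is positive on the half-plane cut
  off by this side and negative on the half-plane that contains the quadrilateral.  The half-planes
  are bounded by the geodesics from \<open>x\<^sup>2\<close> to infinity, from \<open>- y\<^sup>2\<close> to 0, from \<open>- y\<^sup>2\<close> to infinity and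
  from 0 to \<open>x\<^sup>2\<close>.
\<close>

fun side :: "real \<Rightarrow> real \<Rightarrow> letter \<Rightarrow> complex \<Rightarrow> real" where
  "side x y (Alpha, False) \<tau> = Re \<tau> - x\<^sup>2"
| "side x y (Alpha, True) \<tau> = - (Re \<tau>)\<^sup>2 - (Im \<tau>)\<^sup>2 - y\<^sup>2 * Re \<tau>"
| "side x y (Beta, False) \<tau> = - Re \<tau> - y\<^sup>2"
| "side x y (Beta, True) \<tau> = x\<^sup>2 * Re \<tau> - (Re \<tau>)\<^sup>2 - (Im \<tau>)\<^sup>2"

lemma cusp_SL2:
  assumes "x \<noteq> 0" "y \<noteq> 0" "z \<noteq> 0"
  shows "cusp_A x y z \<in> SL2" "cusp_B x y z \<in> SL2"
  using assms by (simp_all add: SL2_iff cusp_A_def cusp_B_def field_simps power2_eq_square)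

text \<open>
  The points \<open>- y\<^sup>2\<close>, 0 and \<open>x\<^sup>2\<close> divide the real line into four intervals, and each of the four
  half-planes lies over its own interval.
\<close>

lemma side_disjoint:
  assumes "0 < Im \<tau>" "0 < side x y l \<tau>" "l \<noteq> l'"
  shows "side x y l' \<tau> < 0"
proof -
  let ?u = "Re \<tau>"
  have Im2: "0 < (Im \<tau>)\<^sup>2" using assms(1) by simp
  have A: "x\<^sup>2 * ?u \<le> ?u\<^sup>2 \<and> 0 < ?u" if "x\<^sup>2 < ?u"
  proof -
    have "0 < ?u" using that by (meson le_less_trans zero_le_power2)
    then show ?thesis using that by (simp add: power2_eq_square mult_right_mono)
  qed
  have B: "- y\<^sup>2 * ?u \<le> ?u\<^sup>2 \<and> ?u < 0" if "?u < - y\<^sup>2"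
  proof -
    have "?u < 0" using that by (smt (verit) zero_le_power2)
    then show ?thesis using that mult_right_mono_neg[of ?u "- y\<^sup>2" ?u] by (simp add: power2_eq_square)
  qed
  have C: "- y\<^sup>2 < ?u \<and> ?u < 0" if "?u\<^sup>2 + (Im \<tau>)\<^sup>2 + y\<^sup>2 * ?u < 0"
  proof -
    have 1: "?u * (?u + y\<^sup>2) < 0" using that Im2 by (simp add: power2_eq_square algebra_simps)
    then show ?thesis by (smt (verit) mult_less_0_iff zero_le_power2)
  qed
  have D: "?u < x\<^sup>2 \<and> 0 < ?u" if "?u\<^sup>2 + (Im \<tau>)\<^sup>2 < x\<^sup>2 * ?u"
  proof -
    have 1: "?u * (?u - x\<^sup>2) < 0" using that Im2 by (simp add: power2_eq_square algebra_simps)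
    then show ?thesis by (smt (verit) mult_less_0_iff zero_le_power2)
  qed
  have pos: "0 \<le> y\<^sup>2 * ?u" if "0 < ?u" using that by simp
  have neg: "x\<^sup>2 * ?u \<le> 0" if "?u < 0" using that by (simp add: mult_nonneg_nonpos)
  have sq: "0 \<le> x\<^sup>2" "0 \<le> y\<^sup>2" "0 \<le> ?u\<^sup>2" by simp_all
  obtain c i c' i' where l: "l = (c, i)" "l' = (c', i')" by (cases l, cases l')
  show ?thesis
  proof (cases c; cases i)
    assume c: "c = Alpha" "\<not> i"
    then have "x\<^sup>2 < ?u" using assms(2) l by simp
    then show ?thesis using assms(3) c l by (cases c'; cases i'; simp; use A pos sq Im2 in linarith)
  next
    assume c: "c = Alpha" "i"
    then have "?u\<^sup>2 + (Im \<tau>)\<^sup>2 + y\<^sup>2 * ?u < 0" using assms(2) l by simp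
    then show ?thesis using assms(3) c l by (cases c'; cases i'; simp; use C neg sq Im2 in linarith)
  next
    assume c: "c = Beta" "\<not> i"
    then have "?u < - y\<^sup>2" using assms(2) l by simp
    then show ?thesis using assms(3) c l by (cases c'; cases i'; simp; use B neg sq Im2 in linarith)
  next
    assume c: "c = Beta" "i"
    then have "?u\<^sup>2 + (Im \<tau>)\<^sup>2 < x\<^sup>2 * ?u" using assms(2) l by simp
    then show ?thesis using assms(3) c l by (cases c'; cases i'; simp; use D pos sq Im2 in linarith)
  qed
qed

text \<open>
  The side pairing: from \<open>A \<tau> - x\<^sup>2 = z\<^sup>2 \<tau> / (\<tau> + y\<^sup>2)\<close> the real part of the left-hand side is
  \<open>z\<^sup>2 (\<bar>\<tau>\<bar>\<^sup>2 + y\<^sup>2 Re \<tau>)\<close> divided by a positive number, and similarly for the second generator.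
\<close>

lemma side_cusp:
  assumes "0 < x" "0 < y" "0 < z" "0 < Im \<tau>"
  shows "\<exists>k>0. side x y (Alpha, False) (moebius (cusp_A x y z) \<tau>) = - k * side x y (Alpha, True) \<tau>"
    and "\<exists>k>0. side x y (Beta, False) (moebius (cusp_B x y z) \<tau>) = - k * side x y (Beta, True) \<tau>"
proof -
  have nz: "\<tau> + of_real (y\<^sup>2) \<noteq> 0" "of_real (x\<^sup>2) - \<tau> \<noteq> 0"
    using assms(4) by (auto simp: complex_eq_iff)
  have cancel: "(N / k) / (D / k) = N / D" if "k \<noteq> 0" for N D k :: complex
    using that by simp
  have "moebius (cusp_A x y z) \<tau> = of_real (x\<^sup>2) + of_real (z\<^sup>2) * \<tau> / (\<tau> + of_real (y\<^sup>2))"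
  proof -
    have d: "of_real (1 / (y * z)) * \<tau> + of_real (y / z) = (\<tau> + of_real (y\<^sup>2)) / of_real (y * z)"
      using assms by (simp add: field_simps power2_eq_square)
    have n: "of_real ((x\<^sup>2 + z\<^sup>2) / (y * z)) * \<tau> + of_real (x\<^sup>2 * y / z)
       = (of_real (x\<^sup>2) * (\<tau> + of_real (y\<^sup>2)) + of_real (z\<^sup>2) * \<tau>) / of_real (y * z)"
      using assms by (simp add: field_simps power2_eq_square)
    have k: "complex_of_real (y * z) \<noteq> 0" using assms by simp
    show ?thesis using nz
      by (simp only: moebius_def cusp_A_def mk_mat2_nth d n cancel[OF k]) (simp add: add_divide_distrib)
  qed
  moreover define D where "D = (Re \<tau> + y\<^sup>2)\<^sup>2 + (Im \<tau>)\<^sup>2"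
  moreover have "0 < D" using assms(4) by (simp add: D_def sum_power2_gt_zero_iff)
  ultimately show "\<exists>k>0. side x y (Alpha, False) (moebius (cusp_A x y z) \<tau>) = - k * side x y (Alpha, True) \<tau>"
    using assms by (intro exI[of _ "z\<^sup>2 / D"])
      (simp add: Re_divide add_divide_distrib[symmetric] D_def[symmetric], simp add: field_simps power2_eq_square)
  have "moebius (cusp_B x y z) \<tau> = of_real (z\<^sup>2) * \<tau> / (of_real (x\<^sup>2) - \<tau>) - of_real (y\<^sup>2)"
  proof -
    have d: "of_real (- (1 / (x * z))) * \<tau> + of_real (x / z) = (of_real (x\<^sup>2) - \<tau>) / of_real (x * z)"
      using assms by (simp add: field_simps power2_eq_square)
    have n: "of_real ((y\<^sup>2 + z\<^sup>2) / (x * z)) * \<tau> + of_real (- (x * y\<^sup>2 / z))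
       = (of_real (z\<^sup>2) * \<tau> - of_real (y\<^sup>2) * (of_real (x\<^sup>2) - \<tau>)) / of_real (x * z)"
      using assms by (simp add: field_simps power2_eq_square)
    have k: "complex_of_real (x * z) \<noteq> 0" using assms by simp
    show ?thesis using nz
      by (simp only: moebius_def cusp_B_def mk_mat2_nth d n cancel[OF k]) (simp add: diff_divide_distrib)
  qed
  moreover define D where "D = (x\<^sup>2 - Re \<tau>)\<^sup>2 + (Im \<tau>)\<^sup>2"
  moreover have "0 < D" using assms(4) by (simp add: D_def sum_power2_gt_zero_iff)
  ultimately show "\<exists>k>0. side x y (Beta, False) (moebius (cusp_B x y z) \<tau>) = - k * side x y (Beta, True) \<tau>"
    using assms by (intro exI[of _ "z\<^sup>2 / D"])
      (simp add: Re_divide diff_divide_distrib[symmetric] D_def[symmetric], simp add: field_simps power2_eq_square)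
qed

lemma side_letter_value:
  assumes "0 < x" "0 < y" "0 < z" "0 < Im \<tau>"
  defines "\<rho> \<equiv> (cusp_A x y z, cusp_B x y z)"
  shows "0 < side x y l (moebius (letter_value \<rho> l) \<tau>) \<longleftrightarrow> side x y (inverse_letter l) \<tau> < 0"
proof -
  have SL: "cusp_A x y z \<in> SL2" "cusp_B x y z \<in> SL2" using assms by (simp_all add: cusp_SL2)
  have forward: "0 < side x y (c, False) (moebius (letter_value \<rho> (c, False)) \<sigma>)
      \<longleftrightarrow> side x y (c, True) \<sigma> < 0"
    "side x y (c, False) (moebius (letter_value \<rho> (c, False)) \<sigma>) < 0
      \<longleftrightarrow> 0 < side x y (c, True) \<sigma>" if "0 < Im \<sigma>" for c \<sigma>
    using side_cusp[OF assms(1-3) that]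
    by (cases c; auto simp: \<rho>_def mult_less_0_iff zero_less_mult_iff simp del: side.simps)+
  obtain c i where l: "l = (c, i)" by (cases l)
  show ?thesis
  proof (cases i)
    case False
    then show ?thesis using forward(1)[OF assms(4)] by (simp add: l)
  next
    case True
    define M where "M = letter_value \<rho> (c, False)"
    have M: "M \<in> SL2" "letter_value \<rho> l = matrix_inv M"
      using SL letter_value_inverse[of \<rho> "(c, False)"] True
      by (auto simp: M_def \<rho>_def l intro!: letter_value_SL2)
    define \<sigma> where "\<sigma> = moebius (matrix_inv M) \<tau>"
    have "0 < Im \<sigma>" "moebius M \<sigma> = \<tau>"
      using M assms(4) by (simp_all add: \<sigma>_def Im_moebius flip: moebius_mult)
    then show ?thesis using forward(2)[of \<sigma> c] M(2) by (simp add: \<sigma>_def[symmetric] l True flip: M_def)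
  qed
qed

text \<open>
  A letter maps the complement of the closed half-plane of its inverse into its own half-plane.  In a
  reduced word the letter is never preceded by its inverse, so the image of the base point stays in
  the half-planes and its position reveals the first letter.
\<close>

lemma ping_pong:
  assumes "0 < x" "0 < y" "0 < z" and \<tau>: "0 < Im \<tau>" "\<And>l. side x y l \<tau> < 0"
    and w: "reduced_word w" "w \<noteq> []"
  shows "0 < side x y (hd w) (moebius (holonomy (cusp_A x y z, cusp_B x y z) w) \<tau>)"
  using w
proof (induction w)
  case (Cons l w)
  let ?\<rho> = "(cusp_A x y z, cusp_B x y z)"
  have SL: "fst ?\<rho> \<in> SL2" "snd ?\<rho> \<in> SL2" using assms by (simp_all add: cusp_SL2)
  let ?\<sigma> = "moebius (holonomy ?\<rho> w) \<tau>"
  have \<sigma>: "0 < Im ?\<sigma>" by (intro Im_moebius holonomy_SL2 SL \<tau>)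
  have "side x y (inverse_letter l) ?\<sigma> < 0"
  proof (cases "w = []")
    case True
    then show ?thesis using \<tau> by simp
  next
    case False
    then show ?thesis using Cons side_disjoint[OF \<sigma>] by (auto simp: reduced_word_Cons)
  qed
  then show ?case
    using side_letter_value[OF assms(1-3) \<sigma>]
    by (simp add: moebius_mult letter_value_SL2[OF SL] holonomy_SL2[OF SL] \<tau>)
qed simp

section \<open>Discreteness\<close>

text \<open>
  In a group, isolation of the identity propagates to all elements by left translation.
\<close>

lemma discrete_subgroup_SL2:
  assumes "G \<subseteq> SL2" and closed: "\<And>M N. M \<in> G \<Longrightarrow> N \<in> G \<Longrightarrow> matrix_inv M ** N \<in> G"
    and near_one: "eventually (\<lambda>M. M \<in> G \<longrightarrow> M = mat 1) (nhds (mat 1))"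
  shows "discrete G"
proof (rule discreteI)
  fix M assume M: "M \<in> G"
  then have SL: "M \<in> SL2" using assms(1) by blast
  have "((\<lambda>N. matrix_inv M ** N) \<longlongrightarrow> matrix_inv M ** M) (nhds M)"
    unfolding matrix_matrix_mult_def
    by (intro vec_tendstoI) (auto intro!: tendsto_intros simp: filterlim_ident)
  then have "filterlim (\<lambda>N. matrix_inv M ** N) (nhds (mat 1)) (nhds M)" using SL by simp
  then have "eventually (\<lambda>N. matrix_inv M ** N \<in> G \<longrightarrow> matrix_inv M ** N = mat 1) (nhds M)"
    by (rule eventually_compose_filterlim[OF near_one])
  then have "eventually (\<lambda>N. N \<in> G \<longrightarrow> N = M) (nhds M)"
  proof (rule eventually_mono, intro impI)
    fix N assume N: "matrix_inv M ** N \<in> G \<longrightarrow> matrix_inv M ** N = mat 1" "N \<in> G"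
    then have "matrix_inv M ** N = mat 1" using closed M by blast
    then have "M ** (matrix_inv M ** N) = M ** mat 1" by simp
    then show "N = M" using SL by simp
  qed
  then show "M isolated_in G"
    using M by (auto simp: isolated_in_altdef eventually_at_filter elim: eventually_mono)
qed

text \<open>
  The base point \<open>\<i>\<close> lies inside the open quadrilateral and every nontrivial element moves it out of
  it.  Elements near the identity move it only a little, so they are trivial.
\<close>

lemma cusp_group_discrete_free:
  assumes "0 < x" "0 < y" "0 < z"
  defines "\<rho> \<equiv> (cusp_A x y z, cusp_B x y z)"
  shows "eventually (\<lambda>M. M \<in> range (holonomy \<rho>) \<longrightarrow> M = mat 1) (nhds (mat 1))"
    and "reduced_word w \<Longrightarrow> w \<noteq> [] \<Longrightarrow> holonomy \<rho> w \<noteq> mat 1 \<and> holonomy \<rho> w \<noteq> - mat 1"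
proof -
  have SL: "fst \<rho> \<in> SL2" "snd \<rho> \<in> SL2" using assms by (simp_all add: \<rho>_def cusp_SL2)
  have base: "side x y l \<i> < 0" for l
    using assms by (cases "(x, y, l, \<i>)" rule: side.cases) auto
  have moved: "\<exists>l. 0 < side x y l (moebius (holonomy \<rho> w) \<i>)" if "reduced_word w" "w \<noteq> []" for w
    using ping_pong[OF assms(1-3) _ base that] unfolding \<rho>_def
    by (intro exI[of _ "hd w"]) simp
  show "holonomy \<rho> w \<noteq> mat 1 \<and> holonomy \<rho> w \<noteq> - mat 1" if "reduced_word w" "w \<noteq> []"
  proof -
    have "moebius M \<i> \<noteq> \<i>" if "M = holonomy \<rho> w" for M
      using that moved[OF \<open>reduced_word w\<close> \<open>w \<noteq> []\<close>] base by (metis less_asym)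
    moreover have "moebius (- mat 1) \<i> = \<i>" by (simp add: moebius_def)
    ultimately show ?thesis by (metis moebius_one)
  qed
  have "((\<lambda>M. moebius M \<i>) \<longlongrightarrow> moebius (mat 1) \<i>) (nhds (mat 1))"
    unfolding moebius_def by (intro tendsto_intros filterlim_ident) simp
  then have lim: "((\<lambda>M. moebius M \<i>) \<longlongrightarrow> \<i>) (nhds (mat 1))" by simp
  have lim_side: "((\<lambda>M. side x y l (moebius M \<i>)) \<longlongrightarrow> side x y l \<i>) (nhds (mat 1))" for l
  proof -
    obtain c i where l: "l = (c, i)" by (cases l)
    show ?thesis unfolding l
      by (cases c; cases i; simp only: side.simps; intro tendsto_intros lim)
  qed
  have "eventually (\<lambda>M. side x y l (moebius M \<i>) < 0) (nhds (mat 1))" for l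
    using order_tendstoD(2)[OF lim_side base] .
  then have "eventually (\<lambda>M. \<forall>l\<in>{(Alpha, False), (Alpha, True), (Beta, False), (Beta, True)}.
      side x y l (moebius M \<i>) < 0) (nhds (mat 1))"
    by (intro eventually_ball_finite) auto
  then show "eventually (\<lambda>M. M \<in> range (holonomy \<rho>) \<longrightarrow> M = mat 1) (nhds (mat 1))"
  proof (rule eventually_mono, intro impI)
    fix M assume *: "\<forall>l\<in>{(Alpha, False), (Alpha, True), (Beta, False), (Beta, True)}.
      side x y l (moebius M \<i>) < 0" and "M \<in> range (holonomy \<rho>)"
    have all: "side x y l (moebius M \<i>) < 0" for l
      using * by (cases "(x, y, l, \<i>)" rule: side.cases) auto
    obtain w where w: "reduced_word w" "M = holonomy \<rho> w"
      using \<open>M \<in> range (holonomy \<rho>)\<close> ex_reduced_word[OF SL] by (metis imageE)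
    then have "w = []" using moved all by (metis less_asym)
    then show "M = mat 1" using w by simp
  qed
qed


section \<open>Conjugating a pair with Markov traces into the normal form\<close>

lemma mat2_vector_mult_nth: "(M *v v) $ i = M$i$1 * v$1 + M$i$2 * (v :: real^2)$2"
  for M :: mat2
  by (simp add: matrix_vector_mult_def sum_2)

text \<open>
  The vector form of Cayley--Hamilton makes products of the generators reducible to the traces, which
  is how the traces alone determine the pair up to conjugation.
\<close>

lemma cayley_hamilton_SL2:
  assumes "M \<in> SL2"
  shows "M *v (M *v v) = trace M *\<^sub>R (M *v v) - v"
proof -
  have d: "M$1$1 * M$2$2 = 1 + M$1$2 * M$2$1" using assms by (simp add: SL2_iff)
  have "v$1 = (M$1$1 * M$2$2 - M$1$2 * M$2$1) * v$1" "v$2 = (M$1$1 * M$2$2 - M$1$2 * M$2$1) * v$2"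
    by (simp_all add: d)
  then show ?thesis
    by (simp add: vec_eq_iff forall_2 mat2_vector_mult_nth trace_mat2 algebra_simps)
qed

lemma singular_mat2_kernel:
  assumes "M$1$1 * M$2$2 = M$1$2 * (M::mat2)$2$1"
  obtains v where "v \<noteq> 0" "M *v v = 0"
proof (cases "M$1$1 = 0 \<and> M$1$2 = 0")
  case True
  show ?thesis
  proof (cases "M$2$1 = 0 \<and> M$2$2 = 0")
    case True
    with \<open>M$1$1 = 0 \<and> M$1$2 = 0\<close> show ?thesis
      by (intro that[of "vector [1, 0]"]) (auto simp: vec_eq_iff forall_2 mat2_vector_mult_nth)
  next
    case False
    with \<open>M$1$1 = 0 \<and> M$1$2 = 0\<close> show ?thesis
      by (intro that[of "vector [M$2$2, - M$2$1]"]) (auto simp: vec_eq_iff forall_2 mat2_vector_mult_nth)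
  qed
next
  case False
  with assms show ?thesis
    by (intro that[of "vector [M$1$2, - M$1$1]"])
      (auto simp: vec_eq_iff forall_2 mat2_vector_mult_nth algebra_simps)
qed

lemma eigenvalue_SL2:
  assumes "M \<in> SL2" "M *v v = c *\<^sub>R v" "v \<noteq> 0"
  shows "c\<^sup>2 + 1 = trace M * c"
proof -
  have "(c\<^sup>2 - trace M * c + 1) *\<^sub>R v = 0"
    using cayley_hamilton_SL2[OF assms(1), of v] assms(2)
    by (simp add: matrix_vector_mult_scaleR power2_eq_square algebra_simps)
  then show ?thesis using assms(3) by simp
qed

text \<open>
  On the line of a common eigenvector the eigenvalues multiply, so the traces are \<open>c + 1/c\<close>,
  \<open>d + 1/d\<close> and \<open>cd + 1/(cd)\<close>; this is incompatible with the Markov equation.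
\<close>

lemma common_eigenvector_traces:
  assumes "A \<in> SL2" "B \<in> SL2" "v \<noteq> 0" "A *v v = c *\<^sub>R v" "B *v v = d *\<^sub>R v"
  shows "(trace A)\<^sup>2 + (trace B)\<^sup>2 + (trace (A ** B))\<^sup>2 = trace A * trace B * trace (A ** B) + 4"
proof -
  have "(A ** B) *v v = (c * d) *\<^sub>R v"
    using assms(4,5) by (simp add: matrix_vector_mul_assoc[symmetric] matrix_vector_mult_scaleR)
  then have e: "trace (A ** B) * (c * d) = (c * d)\<^sup>2 + 1" "trace A * c = c\<^sup>2 + 1" "trace B * d = d\<^sup>2 + 1"
    using assms eigenvalue_SL2 SL2_mult by metis+
  have nz: "c \<noteq> 0" "d \<noteq> 0" using e(2,3) by auto
  then have *: "trace (A ** B) = ((c * d)\<^sup>2 + 1) / (c * d)" "trace A = (c\<^sup>2 + 1) / c" "trace B = (d\<^sup>2 + 1) / d"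
    using e by (simp_all add: nonzero_eq_divide_eq)
  show ?thesis unfolding * using nz by (simp add: field_simps power2_eq_square)
qed

text \<open>
  A nonzero vector \<open>p\<close> fixed up to sign by the commutator satisfies
  \<open>(xy + z) p = y A p + x B p\<close>, as one sees by eliminating the inverses with Cayley--Hamilton.  The
  proof takes this linear equation as its starting point: its matrix is singular precisely because of
  the Markov equation.  A solution \<open>p\<close> and the second basis vector \<open>q\<close> read off from the first column
  of \<open>cusp_A\<close> form the basis of the normal form.
\<close>

lemma ex_cusp_normal_form:
  assumes A: "A \<in> SL2" and B: "B \<in> SL2"
    and x: "x = trace A" and y: "y = trace B" and z: "z = trace (A ** B)"
    and pos: "0 < x" "0 < y" "0 < z" and markov: "x\<^sup>2 + y\<^sup>2 + z\<^sup>2 = x * y * z"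
  obtains P Q where "Q ** P = mat 1" "A = P ** cusp_A x y z ** Q" "B = P ** cusp_B x y z ** Q"
proof -
  define K where "K = mk_mat2 (x * y + z - y * A$1$1 - x * B$1$1) (- y * A$1$2 - x * B$1$2)
    (- y * A$2$1 - x * B$2$1) (x * y + z - y * A$2$2 - x * B$2$2)"
  have "K$1$1 * K$2$2 - K$1$2 * K$2$1 = (x * y + z)\<^sup>2 - (x * y + z) * (y * trace A + x * trace B)
      + y\<^sup>2 * (A$1$1 * A$2$2 - A$1$2 * A$2$1) + x\<^sup>2 * (B$1$1 * B$2$2 - B$1$2 * B$2$1)
      + x * y * (trace A * trace B - trace (A ** B))"
    by (simp add: K_def trace_mat2 mat2_mult_nth power2_eq_square algebra_simps)
  also have "\<dots> = x\<^sup>2 + y\<^sup>2 + z\<^sup>2 - x * y * z"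
    using A B by (simp add: x[symmetric] y[symmetric] z[symmetric] SL2_iff power2_eq_square algebra_simps)
  finally have "K$1$1 * K$2$2 = K$1$2 * K$2$1" using markov by simp
  then obtain p where p: "p \<noteq> 0" "K *v p = 0" using singular_mat2_kernel by blast
  have Kp: "K *v p = (x * y + z) *\<^sub>R p - y *\<^sub>R (A *v p) - x *\<^sub>R (B *v p)"
    by (simp add: K_def vec_eq_iff forall_2 mat2_vector_mult_nth algebra_simps)
  define q where "q = (y * z) *\<^sub>R (A *v p) - (x\<^sup>2 + z\<^sup>2) *\<^sub>R p"
  have q2: "q = (y\<^sup>2 + z\<^sup>2) *\<^sub>R p - (x * z) *\<^sub>R (B *v p)"
  proof -
    have yAp: "y *\<^sub>R (A *v p) = (x * y + z) *\<^sub>R p - x *\<^sub>R (B *v p)"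
      using Kp p(2) by (simp add: algebra_simps)
    have "q = z *\<^sub>R (y *\<^sub>R (A *v p)) - (x\<^sup>2 + z\<^sup>2) *\<^sub>R p"
      by (simp add: q_def mult.commute)
    then have "q = (z * (x * y + z) - (x\<^sup>2 + z\<^sup>2)) *\<^sub>R p - (x * z) *\<^sub>R (B *v p)"
      unfolding yAp by (simp add: algebra_simps)
    also have "z * (x * y + z) - (x\<^sup>2 + z\<^sup>2) = y\<^sup>2 + z\<^sup>2"
      using markov by (simp add: power2_eq_square algebra_simps)
    finally show ?thesis .
  qed
  have Ap: "A *v p = ((x\<^sup>2 + z\<^sup>2) / (y * z)) *\<^sub>R p + (1 / (y * z)) *\<^sub>R q"
    using pos by (simp add: q_def scaleR_diff_right)
  have Bp: "B *v p = ((y\<^sup>2 + z\<^sup>2) / (x * z)) *\<^sub>R p + (- (1 / (x * z))) *\<^sub>R q"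
    using pos by (simp add: q2 scaleR_diff_right)
  have Aq: "A *v q = (x\<^sup>2 * y / z) *\<^sub>R p + (y / z) *\<^sub>R q"
  proof -
    have "A *v q = (x * y * z - (x\<^sup>2 + z\<^sup>2)) *\<^sub>R (A *v p) - (y * z) *\<^sub>R p"
      by (simp add: cayley_hamilton_SL2[OF A] q_def matrix_vector_mult_diff_distrib matrix_vector_mult_scaleR x[symmetric] algebra_simps)
    also have "x * y * z - (x\<^sup>2 + z\<^sup>2) = y\<^sup>2" using markov by simp
    also have "y\<^sup>2 *\<^sub>R (A *v p) - (y * z) *\<^sub>R p = (y\<^sup>2 * ((x\<^sup>2 + z\<^sup>2) / (y * z)) - y * z) *\<^sub>R p + (y\<^sup>2 * (1 / (y * z))) *\<^sub>R q"
      by (simp add: Ap scaleR_add_right scaleR_diff_left)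
    also have "y\<^sup>2 * ((x\<^sup>2 + z\<^sup>2) / (y * z)) - y * z = x\<^sup>2 * y / z"
      using pos by (simp add: field_simps power2_eq_square)
    also have "y\<^sup>2 * (1 / (y * z)) = y / z" using pos by (simp add: power2_eq_square)
    finally show ?thesis .
  qed
  have Bq: "B *v q = (- (x * y\<^sup>2 / z)) *\<^sub>R p + (x / z) *\<^sub>R q"
  proof -
    have "B *v q = (x * z) *\<^sub>R p - (x * y * z - (y\<^sup>2 + z\<^sup>2)) *\<^sub>R (B *v p)"
      by (simp add: cayley_hamilton_SL2[OF B] q2 matrix_vector_mult_diff_distrib matrix_vector_mult_scaleR y[symmetric] algebra_simps)
    also have "x * y * z - (y\<^sup>2 + z\<^sup>2) = x\<^sup>2" using markov by simp
    also have "(x * z) *\<^sub>R p - x\<^sup>2 *\<^sub>R (B *v p) = (x * z - x\<^sup>2 * ((y\<^sup>2 + z\<^sup>2) / (x * z))) *\<^sub>R p + (x\<^sup>2 * (1 / (x * z))) *\<^sub>R q"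
      by (simp add: Bp scaleR_diff_right scaleR_diff_left)
    also have "x * z - x\<^sup>2 * ((y\<^sup>2 + z\<^sup>2) / (x * z)) = - (x * y\<^sup>2 / z)"
      using pos by (simp add: field_simps power2_eq_square)
    also have "x\<^sup>2 * (1 / (x * z)) = x / z" using pos by (simp add: power2_eq_square)
    finally show ?thesis .
  qed
  define P where "P = mk_mat2 (p$1) (q$1) (p$2) (q$2)"
  have AP: "A ** P = P ** cusp_A x y z" and BP: "B ** P = P ** cusp_B x y z"
    using Ap Aq Bp Bq
    by (auto simp: P_def cusp_A_def cusp_B_def mat2_eq_iff mat2_mult_nth vec_eq_iff forall_2
        mat2_vector_mult_nth mult.commute)
  \<comment> \<open>If \<open>p\<close> and \<open>q\<close> were dependent, then \<open>p\<close> would be a common eigenvector.\<close>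
  have "det P \<noteq> 0"
  proof
    assume "det P = 0"
    then have "(y * z) * (p$1 * (A *v p)$2 - p$2 * (A *v p)$1) = 0"
      by (simp add: P_def det_2 q_def algebra_simps)
    then have cross: "p$1 * (A *v p)$2 = p$2 * (A *v p)$1" using pos by simp
    have "\<exists>c. A *v p = c *\<^sub>R p"
    proof (cases "p$1 = 0")
      case True
      then have "p$2 \<noteq> 0" using p(1) by (simp add: vec_eq_iff forall_2)
      with True cross show ?thesis
        by (intro exI[of _ "(A *v p)$2 / p$2"]) (simp add: vec_eq_iff forall_2)
    next
      case False
      with cross show ?thesis
        by (intro exI[of _ "(A *v p)$1 / p$1"]) (simp add: vec_eq_iff forall_2 field_simps)
    qed
    then obtain c where c: "A *v p = c *\<^sub>R p" by blast
    moreover have "B *v p = ((x * y + z - y * c) / x) *\<^sub>R p"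
    proof -
      have "x *\<^sub>R (B *v p) = (x * y + z - y * c) *\<^sub>R p"
        using Kp p(2) c by (simp add: algebra_simps)
      then have "(1 / x) *\<^sub>R x *\<^sub>R (B *v p) = (1 / x) *\<^sub>R (x * y + z - y * c) *\<^sub>R p" by simp
      then show ?thesis using pos by simp
    qed
    ultimately show False
      using common_eigenvector_traces[OF A B p(1)] markov x y z by fastforce
  qed
  then obtain Q where Q: "Q ** P = mat 1" "P ** Q = mat 1"
    by (metis invertible_def invertible_det_nz)
  have "A = P ** cusp_A x y z ** Q" "B = P ** cusp_B x y z ** Q"
    using AP BP Q by (metis matrix_mul_assoc matrix_mul_rid)+
  with Q that show ?thesis by blast
qed

lemma markov_pair_discrete_free:
  assumes A: "A \<in> SL2" and B: "B \<in> SL2"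
    and x: "x = trace A" and y: "y = trace B" and z: "z = trace (A ** B)"
    and pos: "0 < x" "0 < y" "0 < z" and markov: "x\<^sup>2 + y\<^sup>2 + z\<^sup>2 = x * y * z"
  shows "discrete (range (holonomy (A, B)))"
    and "reduced_word w \<Longrightarrow> w \<noteq> [] \<Longrightarrow> holonomy (A, B) w \<noteq> mat 1 \<and> holonomy (A, B) w \<noteq> - mat 1"
proof -
  let ?\<rho> = "(cusp_A x y z, cusp_B x y z)"
  obtain P Q where PQ: "Q ** P = mat 1" "A = P ** cusp_A x y z ** Q" "B = P ** cusp_B x y z ** Q"
    using ex_cusp_normal_form[OF assms] .
  have QP: "P ** Q = mat 1" using PQ(1) matrix_left_right_inverse by blast
  have "holonomy (A, B) v = P ** holonomy ?\<rho> v ** Q" for v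
    unfolding PQ(2,3) using pos by (intro holonomy_similar PQ cusp_SL2) simp_all
  then have "Q ** holonomy (A, B) v ** P = (Q ** P) ** holonomy ?\<rho> v ** (Q ** P)" for v
    by (simp add: matrix_mul_assoc)
  then have hol: "Q ** holonomy (A, B) v ** P = holonomy ?\<rho> v" for v
    using PQ(1) by simp
  show "holonomy (A, B) w \<noteq> mat 1 \<and> holonomy (A, B) w \<noteq> - mat 1" if "reduced_word w" "w \<noteq> []"
  proof -
    have "Q ** (- mat 1) ** P = - (Q ** P)"
      by (simp add: mat2_eq_iff mat2_mult_nth)
    then show ?thesis
      using cusp_group_discrete_free(2)[OF pos that] hol[of w] PQ(1) by (metis matrix_mul_rid)
  qed
  show "discrete (range (holonomy (A, B)))"
  proof (rule discrete_subgroup_SL2)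
    show "range (holonomy (A, B)) \<subseteq> SL2" using A B holonomy_SL2[of "(A, B)"] by auto
    show "matrix_inv M ** N \<in> range (holonomy (A, B))"
      if "M \<in> range (holonomy (A, B))" "N \<in> range (holonomy (A, B))" for M N
      using that A B by (auto simp: matrix_inv_holonomy simp flip: holonomy_append)
    have "((\<lambda>M. Q ** M ** P) \<longlongrightarrow> Q ** mat 1 ** P) (nhds (mat 1))"
      unfolding matrix_matrix_mult_def
      by (intro vec_tendstoI) (auto intro!: tendsto_intros simp: filterlim_ident)
    then have "filterlim (\<lambda>M. Q ** M ** P) (nhds (mat 1)) (nhds (mat 1))" using PQ(1) by simp
    from eventually_compose_filterlim[OF cusp_group_discrete_free(1)[OF pos] this]
    show "eventually (\<lambda>M. M \<in> range (holonomy (A, B)) \<longrightarrow> M = mat 1) (nhds (mat 1))"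
    proof (rule eventually_mono, intro impI)
      fix M assume *: "Q ** M ** P \<in> range (holonomy ?\<rho>) \<longrightarrow> Q ** M ** P = mat 1"
        and "M \<in> range (holonomy (A, B))"
      then have "Q ** M ** P = mat 1" using hol by auto
      then have "P ** (Q ** M ** P) ** Q = mat 1" using QP by simp
      moreover have "P ** (Q ** M ** P) ** Q = (P ** Q) ** M ** (P ** Q)"
        by (simp add: matrix_mul_assoc)
      ultimately show "M = mat 1" using QP by simp
    qed
  qed
qed


section \<open>The axis of alpha and the orientation of the marking\<close>

lemma SL2_translation [simp, intro]: "g \<in> SL2 \<Longrightarrow> translation g d \<in> SL2"
  by (simp add: translation_def)

lemma translation_add:
  assumes "g \<in> SL2"
  shows "translation g c ** translation g d = translation g (c + d)"
proof -
  have "translation g c ** translation g d = g ** (dilation c ** dilation d) ** matrix_inv g"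
    using assms by (simp add: translation_def flip: matrix_mul_assoc)
  then show ?thesis by (simp add: dilation_add translation_def)
qed

lemma translation_0 [simp]: "g \<in> SL2 \<Longrightarrow> translation g 0 = mat 1"
  by (simp add: translation_def)

lemma matrix_inv_translation: "g \<in> SL2 \<Longrightarrow> matrix_inv (translation g d) = translation g (- d)"
  by (rule matrix_inv_eqI) (simp add: translation_add)

lemma translation_conj:
  assumes "h \<in> SL2" "g \<in> SL2"
  shows "translation (h ** g) d = h ** translation g d ** matrix_inv h"
  using assms by (simp add: translation_def matrix_inv_mult_SL2 matrix_mul_assoc)

lemma trace_translation:
  assumes "g \<in> SL2"
  shows "trace (translation g d) = exp (d/2) + exp (- d/2)"
  using assms by (simp add: translation_def trace_similar) (simp add: trace_mat2)

text \<open>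
  The left-hand condition says that \<open>M\<close> maps each point \<open>\<i> y\<close> of the imaginary axis to a point with
  negative real part; the right-hand side is the numerator of that real part.
\<close>

lemma left_side_iff:
  assumes "g \<in> SL2" "B \<in> SL2"
  defines "M \<equiv> matrix_inv g ** B ** g"
  shows "moebius B ` geodesic_line g \<subseteq> left_side g \<longleftrightarrow>
    (\<forall>y>0. M$1$2 * M$2$2 + M$1$1 * M$2$1 * y\<^sup>2 < 0)"
proof -
  have M: "M \<in> SL2" "g ** M = B ** g" using assms by (auto simp: M_def matrix_mul_assoc[symmetric])
  have axis: "moebius B (moebius g z) = moebius g (moebius M z)" if "0 < Im z" for z
    using that assms M by (simp flip: moebius_mult)
  have inv: "moebius (matrix_inv g) (moebius g z) = z" if "0 < Im z" for z
    using that assms by (simp flip: moebius_mult)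
  have left: "moebius g z \<in> left_side g \<longleftrightarrow> Re z < 0" if z: "0 < Im z" for z
  proof
    assume "moebius g z \<in> left_side g"
    then obtain z' where "0 < Im z'" "Re z' < 0" "moebius g z = moebius g z'"
      by (auto simp: left_side_def upper_half_def)
    then show "Re z < 0" using inv z by metis
  next
    assume "Re z < 0"
    then show "moebius g z \<in> left_side g" using z by (auto simp: left_side_def upper_half_def)
  qed
  have "moebius B ` geodesic_line g \<subseteq> left_side g \<longleftrightarrow>
      (\<forall>z. 0 < Im z \<and> Re z = 0 \<longrightarrow> moebius B (moebius g z) \<in> left_side g)"
    by (auto simp: geodesic_line_def upper_half_def)
  also have "\<dots> \<longleftrightarrow> (\<forall>z. 0 < Im z \<and> Re z = 0 \<longrightarrow> Re (moebius M z) < 0)"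
    using axis left Im_moebius[OF M(1)] by simp
  also have "\<dots> \<longleftrightarrow> (\<forall>y>0. Re (moebius M (Complex 0 y)) < 0)"
    by (metis complex.collapse complex.sel)
  also have "\<dots> \<longleftrightarrow> (\<forall>y>0. M$1$2 * M$2$2 + M$1$1 * M$2$1 * y\<^sup>2 < 0)"
  proof -
    have "Re (moebius M (Complex 0 y)) < 0 \<longleftrightarrow> M$1$2 * M$2$2 + M$1$1 * M$2$1 * y\<^sup>2 < 0" if "0 < y" for y
    proof -
      let ?D = "(M$2$2)\<^sup>2 + (M$2$1 * y)\<^sup>2"
      have "0 < ?D" using SL2_denominator_nonzero[OF M(1), of "Complex 0 y"] that
        by (auto simp: complex_eq_iff sum_power2_gt_zero_iff)
      moreover have "Re (moebius M (Complex 0 y)) = (M$1$2 * M$2$2 + M$1$1 * M$2$1 * y\<^sup>2) / ?D"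
        by (simp add: moebius_def Re_divide power2_eq_square mult.assoc mult.left_commute)
      ultimately show ?thesis by (simp add: divide_less_0_iff)
    qed
    then show ?thesis by blast
  qed
  finally show ?thesis .
qed

text \<open>
  With \<open>k\<close> and \<open>l\<close> the eigenvalues of \<open>\<rho>(\<alpha>)\<close> and \<open>p\<close> and \<open>u\<close> the diagonal entries of \<open>\<rho>(\<beta>)\<close>, the
  Markov equation only constrains the product \<open>p u\<close>, which a twist along the axis preserves.
\<close>

lemma markov_product:
  fixes k l p u :: real
  assumes "k * l = 1"
    and "(k + l)\<^sup>2 + (p + u)\<^sup>2 + (k * p + l * u)\<^sup>2 = (k + l) * (p + u) * (k * p + l * u)"
  shows "p * u * (k - l)\<^sup>2 = (k + l)\<^sup>2"
proof -
  have "(k + l) * (p + u) * (k * p + l * u) - (p + u)\<^sup>2 - (k * p + l * u)\<^sup>2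
      = p * u * ((k + l)\<^sup>2 - 2 - 2 * (k * l)) + (k * l - 1) * (p\<^sup>2 + u\<^sup>2)"
    by (simp add: power2_eq_square algebra_simps)
  also have "\<dots> = p * u * ((k + l)\<^sup>2 - 4 * (k * l))" by (simp add: assms(1))
  also have "(k + l)\<^sup>2 - 4 * (k * l) = (k - l)\<^sup>2" by (simp add: power2_eq_square algebra_simps)
  finally show ?thesis using assms(2) by simp
qed

text \<open>
  By Fricke's identity \<open>trace_commutator_SL2\<close> the equation says that the commutator has trace
  \<open>- 2\<close>, as for a cusp.
\<close>

definition markov_traces :: "rep \<Rightarrow> bool" where
  "markov_traces \<rho> \<longleftrightarrow> fst \<rho> \<in> SL2 \<and> snd \<rho> \<in> SL2 \<and>
     2 < trace (fst \<rho>) \<and> 2 < trace (snd \<rho>) \<and> 2 < trace (fst \<rho> ** snd \<rho>) \<and>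
     (trace (fst \<rho>))\<^sup>2 + (trace (snd \<rho>))\<^sup>2 + (trace (fst \<rho> ** snd \<rho>))\<^sup>2
       = trace (fst \<rho>) * trace (snd \<rho>) * trace (fst \<rho> ** snd \<rho>)"

text \<open>
  In the coordinates given by \<open>g\<close> the axis of \<open>\<rho>(\<alpha>)\<close> is the imaginary axis and beta crosses it from
  right to left.  The translation length \<open>t\<close> carries a sign: a frame may a priori point against the
  direction of \<open>\<rho>(\<alpha>)\<close>, as \<^const>\<open>left_twist\<close> allows.
\<close>

definition marking_frame :: "rep \<Rightarrow> mat2 \<Rightarrow> real \<Rightarrow> bool" where
  "marking_frame \<rho> g t \<longleftrightarrow> g \<in> SL2 \<and> fst \<rho> = translation g t \<and>
     moebius (snd \<rho>) ` geodesic_line g \<subseteq> left_side g"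

lemma frame_traces:
  assumes "g \<in> SL2" "B \<in> SL2"
  defines "M \<equiv> matrix_inv g ** B ** g"
  shows "trace B = M$1$1 + M$2$2"
    and "trace (translation g t ** B) = exp (t/2) * M$1$1 + exp (- t/2) * M$2$2"
proof -
  have "trace M = trace B" unfolding M_def using assms by (intro trace_similar) simp
  then show "trace B = M$1$1 + M$2$2" by (simp add: trace_mat2)
  have "trace (translation g t ** B) = trace (matrix_inv g ** (translation g t ** B) ** g)"
    using assms by (intro trace_similar[symmetric]) simp
  also have "matrix_inv g ** (translation g t ** B) ** g = dilation t ** M"
    using assms by (simp add: translation_def M_def flip: matrix_mul_assoc)
  finally show "trace (translation g t ** B) = exp (t/2) * M$1$1 + exp (- t/2) * M$2$2"
    by (simp add: trace_mat2 mat2_mult_nth)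
qed

text \<open>
  The Markov equation makes \<open>p u > 1\<close>, so the diagonal entries share a sign, positive by the trace,
  and so do the off-diagonal ones, as their product is \<open>p u - 1\<close>; that the image of \<open>\<i>\<close> lies on the
  left makes the latter negative.
\<close>

lemma frame_signs:
  assumes "markov_traces \<rho>" "marking_frame \<rho> g t"
  defines "M \<equiv> matrix_inv g ** snd \<rho> ** g"
  shows "0 < M$1$1" "0 < M$2$2" "M$1$2 < 0" "M$2$1 < 0"
    and "M$1$1 * M$2$2 * (exp (t/2) - exp (- t/2))\<^sup>2 = (exp (t/2) + exp (- t/2))\<^sup>2"
proof -
  have g: "g \<in> SL2" and B: "snd \<rho> \<in> SL2" and A: "fst \<rho> = translation g t"
    using assms by (auto simp: marking_frame_def markov_traces_def)
  have M: "M \<in> SL2" using g B by (simp add: M_def)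
  let ?k = "exp (t/2)" and ?l = "exp (- t/2)"
  have kl: "?k * ?l = 1" by (simp flip: exp_add)
  note tr = frame_traces[OF g B, folded M_def] trace_translation[OF g]
  show prod: "M$1$1 * M$2$2 * (?k - ?l)\<^sup>2 = (?k + ?l)\<^sup>2"
    using markov_product[OF kl, of "M$1$1" "M$2$2"] assms(1) by (simp add: markov_traces_def A tr)
  moreover have "(?k + ?l)\<^sup>2 = (?k - ?l)\<^sup>2 + 4"
    using kl by (simp add: power2_eq_square algebra_simps)
  ultimately have "(M$1$1 * M$2$2 - 1) * (?k - ?l)\<^sup>2 = 4" by (simp add: algebra_simps)
  then have "0 < (M$1$1 * M$2$2 - 1) * (?k - ?l)\<^sup>2" by simp
  then have pu: "1 < M$1$1 * M$2$2" by (simp add: zero_less_mult_iff)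
  moreover have sum: "0 < M$1$1 + M$2$2" using assms(1) by (simp add: markov_traces_def tr(1))
  ultimately show "0 < M$1$1" "0 < M$2$2" by (smt (verit) mult_nonneg_nonpos mult_nonneg_nonpos2)+
  have qs: "0 < M$1$2 * M$2$1" using pu M by (simp add: SL2_iff)
  have "M$1$2 * M$2$2 + M$1$1 * M$2$1 < 0"
    using assms(2) left_side_iff[OF g B] by (auto simp: marking_frame_def M_def dest: spec[of _ 1])
  moreover have "0 \<le> M$1$2 * M$2$2 + M$1$1 * M$2$1" if "0 \<le> M$1$2" "0 \<le> M$2$1"
    using that \<open>0 < M$1$1\<close> \<open>0 < M$2$2\<close> by simp
  ultimately show "M$1$2 < 0" "M$2$1 < 0" using qs by (smt (verit) zero_less_mult_iff)+
qed

text \<open>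
  Two frames with different lengths would be related by a matrix that exchanges the two ends of the
  axis.  Such a matrix reverses the signs of the off-diagonal entries of \<open>\<rho>(\<beta>)\<close>, which
  \<open>frame_signs\<close> prescribes.
\<close>

lemma marking_frame_length_unique:
  assumes \<rho>: "markov_traces \<rho>" and g: "marking_frame \<rho> g t" and h: "marking_frame \<rho> h s"
  shows "t = s"
proof (rule ccontr)
  assume "t \<noteq> s"
  have SL: "g \<in> SL2" "h \<in> SL2" "snd \<rho> \<in> SL2"
    using assms by (auto simp: marking_frame_def markov_traces_def)
  define c where "c = matrix_inv g ** h"
  have c: "c \<in> SL2" using SL by (simp add: c_def)
  have "translation g t = translation h s" using g h by (simp add: marking_frame_def)
  then have "matrix_inv g ** translation g t ** h = matrix_inv g ** translation h s ** h" by simp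
  then have dil: "dilation t ** c = c ** dilation s"
    using SL by (simp add: translation_def c_def flip: matrix_mul_assoc)
  define M N where "M = matrix_inv g ** snd \<rho> ** g" and "N = matrix_inv h ** snd \<rho> ** h"
  have MN: "M ** c = c ** N"
    using SL by (simp add: M_def N_def c_def flip: matrix_mul_assoc)
  have "c$1$1 = 0"
    using dil \<open>t \<noteq> s\<close> by (simp add: mat2_eq_iff mat2_mult_nth mult.commute)
  have "c$1$2 * c$2$1 = - 1" using c \<open>c$1$1 = 0\<close> by (simp add: SL2_iff)
  moreover have "M$1$2 * c$2$1 = c$1$2 * N$2$1"
    using MN \<open>c$1$1 = 0\<close> by (simp add: mat2_eq_iff mat2_mult_nth)
  then have "M$1$2 * (c$1$2 * c$2$1) = (c$1$2)\<^sup>2 * N$2$1"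
    by (simp add: power2_eq_square mult.left_commute)
  ultimately have "- M$1$2 = (c$1$2)\<^sup>2 * N$2$1" by simp
  moreover have "M$1$2 < 0" "N$2$1 < 0"
    using frame_signs[OF \<rho> g] frame_signs[OF \<rho> h] by (simp_all add: M_def N_def)
  ultimately show False by (smt (verit) mult_nonneg_nonpos zero_le_power2)
qed

text \<open>
  Fricke's identity, which links the Markov equation to parabolicity of the loop around the puncture.
\<close>

lemma trace_commutator_SL2:
  assumes "A \<in> SL2" "B \<in> SL2"
  shows "trace (A ** B ** matrix_inv A ** matrix_inv B)
    = (trace A)\<^sup>2 + (trace B)\<^sup>2 + (trace (A ** B))\<^sup>2 - trace A * trace B * trace (A ** B) - 2"
proof -
  define a b c d p q r s where "a = A$1$1" "b = A$1$2" "c = A$2$1" "d = A$2$2"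
    "p = B$1$1" "q = B$1$2" "r = B$2$1" "s = B$2$2"
  note defs = this
  have dA: "b * c = a * d - 1" and dB: "q * r = p * s - 1"
    using assms by (simp_all add: SL2_iff defs)
  show ?thesis
    unfolding trace_mat2 mat2_mult_nth matrix_inv_SL2_nth[OF assms(1)] matrix_inv_SL2_nth[OF assms(2)]
      defs[symmetric]
    using dA dB by algebra
qed

text \<open>
  For Markov traces the conditions of discreteness, faithfulness and parabolicity hold by
  themselves, so that membership in Teichmueller space only depends on the orientation.
\<close>

lemma teich_iff_marking_frame:
  assumes \<rho>: "markov_traces \<rho>"
  shows "\<rho> \<in> teich \<longleftrightarrow> (\<exists>g t. 0 < t \<and> marking_frame \<rho> g t)"
proof
  assume "\<rho> \<in> teich"
  then show "\<exists>g t. 0 < t \<and> marking_frame \<rho> g t"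
    by (auto simp: teich_def positively_marked_def directed_axis_def marking_frame_def)
next
  assume "\<exists>g t. 0 < t \<and> marking_frame \<rho> g t"
  then have mark: "positively_marked \<rho>"
    by (auto simp: positively_marked_def directed_axis_def marking_frame_def)
  obtain A B where AB: "\<rho> = (A, B)" by (cases \<rho>)
  have SL: "A \<in> SL2" "B \<in> SL2" using \<rho> by (simp_all add: markov_traces_def AB)
  note markov = markov_pair_discrete_free[OF SL refl refl refl]
  have "discrete (range (holonomy \<rho>))"
    using \<rho> unfolding AB by (intro markov) (auto simp: markov_traces_def)
  moreover have free: "\<forall>w. reduced_word w \<and> w \<noteq> [] \<longrightarrow> holonomy \<rho> w \<noteq> mat 1 \<and> holonomy \<rho> w \<noteq> - mat 1"
    using \<rho> unfolding AB by (intro allI impI markov) (auto simp: markov_traces_def)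
  moreover have "parabolic (holonomy \<rho> commutator_word)"
  proof -
    have "trace (holonomy \<rho> commutator_word) = - 2"
      using \<rho> trace_commutator_SL2[OF SL] by (simp add: AB matrix_mul_assoc markov_traces_def)
    moreover have "reduced_word commutator_word" by simp
    ultimately show ?thesis using free unfolding parabolic_def by fastforce
  qed
  ultimately show "\<rho> \<in> teich" using \<rho> mark by (auto simp: teich_def markov_traces_def)
qed

section \<open>The left twist as a change of the image of beta\<close>

text \<open>
  The compatibility condition at the words alpha and \<open>\<beta>\<^sup>-\<^sup>1\<close>, compared with the displacement of the
  base piece and of the piece across \<open>L\<close>, already determines \<open>\<sigma>\<close> up to conjugation by the
  isometry \<open>h\<close> that moves the base piece.
\<close>

lemma left_twist_similar:
  assumes SL: "fst \<rho> \<in> SL2" "snd \<rho> \<in> SL2" and twist: "left_twist d \<rho> \<sigma>"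
  obtains g h t where "marking_frame \<rho> g t" "h \<in> SL2"
    "fst \<sigma> = h ** fst \<rho> ** matrix_inv h"
    "snd \<sigma> = h ** (snd \<rho> ** translation g (- d)) ** matrix_inv h"
proof -
  obtain g \<Phi> t where g: "g \<in> SL2" "fst \<rho> = translation g t"
      "moebius (snd \<rho>) ` geodesic_line g \<subseteq> left_side g"
    and \<Phi>: "\<And>v. \<Phi> v \<in> SL2" "\<And>v. \<Phi> (v @ [(Alpha, False)]) = \<Phi> v"
      "\<And>v. \<Phi> (v @ [(Beta, True)]) = \<Phi> v ** translation (holonomy \<rho> v ** g) d"
      "\<And>u v. holonomy \<sigma> u ** \<Phi> v = \<Phi> (u @ v) ** holonomy \<rho> u"
    using twist unfolding left_twist_def by blast
  define h where "h = \<Phi> []"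
  have h: "h \<in> SL2" by (simp add: h_def \<Phi>)
  have cancel: "M = N ** matrix_inv h" if "M ** h = N" for M N
    using that h by (metis SL2_inv_mult(1) matrix_mul_assoc matrix_mul_rid)
  have "fst \<sigma> ** h = h ** fst \<rho>"
    using \<Phi>(4)[of "[(Alpha, False)]" "[]"] \<Phi>(2)[of "[]"] by (simp add: h_def)
  then have A: "fst \<sigma> = h ** fst \<rho> ** matrix_inv h" by (rule cancel)
  \<comment> \<open>The condition at beta only shows that \<open>\<sigma>(\<beta>)\<close> is in \<^const>\<open>SL2\<close>; its value comes from the
    condition at the inverse of beta, which involves the displacement.\<close>
  have "snd \<sigma> ** h = \<Phi> [(Beta, False)] ** snd \<rho>"
    using \<Phi>(4)[of "[(Beta, False)]" "[]"] by (simp add: h_def)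
  then have "snd \<sigma> = \<Phi> [(Beta, False)] ** snd \<rho> ** matrix_inv h" by (rule cancel)
  then have B: "snd \<sigma> \<in> SL2" using \<Phi>(1) SL h by simp
  have "matrix_inv (snd \<sigma>) ** h = h ** translation g d ** matrix_inv (snd \<rho>)"
    using \<Phi>(4)[of "[(Beta, True)]" "[]"] \<Phi>(3)[of "[]"] by (simp add: h_def)
  then have inv: "matrix_inv (snd \<sigma>) = h ** translation g d ** matrix_inv (snd \<rho>) ** matrix_inv h"
    by (rule cancel)
  have "snd \<sigma> = matrix_inv (matrix_inv (snd \<sigma>))" using B by simp
  also have "\<dots> = h ** (snd \<rho> ** translation g (- d)) ** matrix_inv h"
    unfolding inv using SL g(1) h
    by (simp add: matrix_inv_mult_SL2 matrix_inv_translation matrix_mul_assoc)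
  finally show ?thesis using that g h A by (auto simp: marking_frame_def)
qed

text \<open>
  Leaving the base piece in place forces \<open>\<Phi> v = \<sigma>(v) \<rho>(v)\<^sup>-\<^sup>1\<close>.  This is constant on pieces because the
  twist commutes with \<open>\<rho>(\<alpha>)\<close>, hence does not change \<open>\<rho>(\<beta>\<alpha>\<beta>\<^sup>-\<^sup>1)\<close>.
\<close>

lemma left_twist_exists:
  assumes SL: "fst \<rho> \<in> SL2" "snd \<rho> \<in> SL2" and frame: "marking_frame \<rho> g t"
  shows "left_twist d \<rho> (fst \<rho>, snd \<rho> ** translation g (- d))"
proof -
  let ?T = "translation g"
  define \<sigma> where "\<sigma> = (fst \<rho>, snd \<rho> ** ?T (- d))"
  define \<Phi> where "\<Phi> v = holonomy \<sigma> v ** matrix_inv (holonomy \<rho> v)" for v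
  have g: "g \<in> SL2" "fst \<rho> = ?T t" using frame by (simp_all add: marking_frame_def)
  have SL': "fst \<sigma> \<in> SL2" "snd \<sigma> \<in> SL2" using SL g by (simp_all add: \<sigma>_def)
  note hol = holonomy_SL2[OF SL] holonomy_SL2[OF SL']
  have \<Phi>_append: "\<Phi> (u @ v) = holonomy \<sigma> u ** \<Phi> v ** matrix_inv (holonomy \<rho> u)" for u v
    using hol by (simp add: \<Phi>_def holonomy_append matrix_inv_mult_SL2 matrix_mul_assoc)
  have \<Phi>_same: "\<Phi> (u @ v) = \<Phi> u" if "\<Phi> v = mat 1" for u v
    unfolding \<Phi>_append that by (simp add: \<Phi>_def)
  have "\<Phi> [(Alpha, False)] = mat 1" using SL by (simp add: \<Phi>_def \<sigma>_def)
  moreover have "\<Phi> [(Beta, False), (Alpha, False), (Beta, True)] = mat 1"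
  proof -
    have commute: "?T (- d) ** (?T t ** (?T d ** N)) = ?T t ** N" for N
      using g by (simp add: matrix_mul_assoc translation_add)
    have "holonomy \<sigma> [(Beta, False), (Alpha, False), (Beta, True)]
        = holonomy \<rho> [(Beta, False), (Alpha, False), (Beta, True)]"
      using SL g by (simp add: \<sigma>_def matrix_inv_mult_SL2 matrix_inv_translation commute flip: matrix_mul_assoc)
    then show ?thesis using hol(1) by (simp only: \<Phi>_def SL2_inv_mult)
  qed
  moreover have "\<Phi> (v @ [(Beta, True)]) = \<Phi> v ** translation (holonomy \<rho> v ** g) d" for v
  proof -
    have "\<Phi> [(Beta, True)] = ?T d"
      using SL g by (simp add: \<Phi>_def \<sigma>_def matrix_inv_mult_SL2 matrix_inv_translation flip: matrix_mul_assoc)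
    then have "\<Phi> (v @ [(Beta, True)]) = holonomy \<sigma> v ** ?T d ** matrix_inv (holonomy \<rho> v)"
      by (simp only: \<Phi>_append)
    also have "\<dots> = \<Phi> v ** translation (holonomy \<rho> v ** g) d"
      using hol g by (simp add: \<Phi>_def translation_conj flip: matrix_mul_assoc)
    finally show ?thesis .
  qed
  moreover have "holonomy \<sigma> u ** \<Phi> v = \<Phi> (u @ v) ** holonomy \<rho> u" for u v
    using hol by (simp add: \<Phi>_append flip: matrix_mul_assoc)
  moreover have "\<Phi> v \<in> SL2" for v using hol by (simp add: \<Phi>_def)
  moreover have "moebius (snd \<rho>) ` geodesic_line g \<subseteq> left_side g"
    using frame by (simp add: marking_frame_def)
  ultimately show ?thesis
    unfolding left_twist_def \<sigma>_def[symmetric]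
    using g \<Phi>_same by (intro exI[of _ g] exI[of _ \<Phi>]) blast
qed

section \<open>Lengths along the earthquake\<close>

lemma cosh_b_alpha_exp:
  assumes "a \<noteq> 0" "p + u = 2 * cosh b" "exp a * p + exp (- a) * u = 2 * cosh c"
  shows "2 * cosh_b_alpha (a, b, c) r = exp (- (r * a)) * p + exp (r * a) * u"
proof -
  have b: "cosh b = (p + u) / 2" and c: "cosh c = (exp a * p + exp (- a) * u) / 2"
    using assms by simp_all
  have ca: "cosh a = (exp a + exp (- a)) / 2" and sa: "sinh a = (exp a - exp (- a)) / 2"
    by (simp_all add: cosh_field_def sinh_field_def)
  have "cosh c - cosh a * cosh b = (p - u) / 2 * sinh a"
    unfolding b c ca sa by (simp add: field_simps)
  then have "(cosh c - cosh a * cosh b) * (sinh (r * a) / sinh a) = (p - u) / 2 * sinh (r * a)"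
    using assms(1) by (simp only:) simp
  moreover have "2 * cosh_b_alpha (a, b, c) r = (p + u) * cosh (r * a)
      - 2 * ((cosh c - cosh a * cosh b) * (sinh (r * a) / sinh a))"
    unfolding cosh_b_alpha_def using assms(2) by (simp add: algebra_simps)
  ultimately have "2 * cosh_b_alpha (a, b, c) r = (p + u) * cosh (r * a) - (p - u) * sinh (r * a)"
    by (simp only:)
  also have "\<dots> = exp (- (r * a)) * p + exp (r * a) * u"
    unfolding cosh_field_def sinh_field_def by (simp add: field_simps)
  finally show ?thesis .
qed

text \<open>
  The diagonal entries of \<open>\<rho>(\<beta>)\<close> in a frame of the structure with lengths \<open>a\<close>, \<open>b\<close>, \<open>c\<close>, obtained
  from the lengths alone.
\<close>

lemma T_len_coefficients:
  assumes "(a, b, c) \<in> T_len"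
  obtains p u where "0 < p" "0 < u" "p + u = 2 * cosh b" "exp a * p + exp (- a) * u = 2 * cosh c"
    "p * u * (sinh a)\<^sup>2 = (cosh a)\<^sup>2"
proof -
  have abc: "0 < a" "(cosh a)\<^sup>2 + (cosh b)\<^sup>2 + (cosh c)\<^sup>2 = 2 * cosh a * cosh b * cosh c"
    using assms by (auto simp: T_len_def)
  define p where "p = (cosh c - cosh b * exp (- a)) / sinh a"
  define u where "u = (cosh b * exp a - cosh c) / sinh a"
  have s: "0 < sinh a" using abc by simp
  have ex: "exp a = cosh a + sinh a" "exp (- a) = cosh a - sinh a"
    by (simp_all add: cosh_plus_sinh cosh_minus_sinh)
  have pu: "p + u = 2 * cosh b" "exp a * p + exp (- a) * u = 2 * cosh c"
    unfolding p_def u_def ex using s by (simp_all add: field_simps power2_eq_square)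
  have "exp a * exp (- a) = 1" by (simp flip: exp_add)
  moreover have sum: "exp a + exp (- a) = 2 * cosh a" and diff: "exp a - exp (- a) = 2 * sinh a"
    by (simp_all add: ex)
  ultimately have "p * u * (2 * sinh a)\<^sup>2 = (2 * cosh a)\<^sup>2"
    using markov_product[of "exp a" "exp (- a)" p u] abc(2) unfolding pu sum diff
    by (simp add: power_mult_distrib)
  then have prod: "p * u * (sinh a)\<^sup>2 = (cosh a)\<^sup>2" by (simp add: power_mult_distrib)
  then have "0 < p * u * (sinh a)\<^sup>2" by simp
  then have "0 < p * u" using s by (simp add: zero_less_mult_iff)
  moreover have "0 < p + u" by (simp add: pu(1))
  ultimately have "0 < p" "0 < u" by (smt (verit) mult_nonneg_nonpos mult_nonneg_nonpos2)+
  with pu prod that show ?thesis by blast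
qed

lemma E_alpha_in_T_len:
  assumes "w \<in> T_len"
  shows "1 < cosh_b_alpha w r" and "E_alpha w r \<in> T_len"
proof -
  obtain a b c where w: "w = (a, b, c)" by (cases w)
  have a: "0 < a" using assms by (auto simp: w T_len_def)
  obtain p u where pu: "0 < p" "0 < u" "p + u = 2 * cosh b" "exp a * p + exp (- a) * u = 2 * cosh c"
      "p * u * (sinh a)\<^sup>2 = (cosh a)\<^sup>2"
    using T_len_coefficients assms unfolding w by blast
  have F: "2 * cosh_b_alpha w r = exp (- (r * a)) * p + exp (r * a) * u" for r
    unfolding w using pu a by (intro cosh_b_alpha_exp) auto
  show gt1: "1 < cosh_b_alpha w r" for r
  proof -
    define P U where "P = exp (- (r * a)) * p" and "U = exp (r * a) * u"
    have PU: "0 < P" "0 < U" using pu by (simp_all add: P_def U_def)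
    have "P * U = p * u" by (simp add: P_def U_def exp_minus)
    moreover have "(p * u - 1) * (sinh a)\<^sup>2 = 1"
      using pu(5) cosh_square_eq[of a] by (simp add: algebra_simps)
    then have "0 < (p * u - 1) * (sinh a)\<^sup>2" by simp
    then have "1 < p * u" by (simp add: zero_less_mult_iff)
    moreover have "4 * (P * U) \<le> (P + U)\<^sup>2"
      using sum_squares_ge_zero[of "P - U" 0] by (simp add: power2_eq_square algebra_simps)
    \<comment> \<open>The inequality of the means, with \<open>P U = p u > 1\<close>.\<close>
    ultimately have "2\<^sup>2 < (P + U)\<^sup>2" by simp
    then have "2 < P + U" using PU by (intro power2_less_imp_less[of 2 "P + U"]) auto
    then show ?thesis using F[of r] by (simp add: P_def U_def)
  qed
  have "(cosh a)\<^sup>2 + (cosh_b_alpha w r)\<^sup>2 + (cosh_b_alpha w (r - 1))\<^sup>2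
      = 2 * cosh a * cosh_b_alpha w r * cosh_b_alpha w (r - 1)"
  proof -
    define P U where "P = exp (- (r * a)) * p" and "U = exp (r * a) * u"
    define k l where "k = exp a" and "l = exp (- a)"
    have kl: "k * l = 1" by (simp add: k_def l_def flip: exp_add)
    have "P * U = p * u" by (simp add: P_def U_def exp_minus)
    moreover have 2: "2 * cosh a = k + l" "2 * sinh a = k - l"
      by (simp_all add: k_def l_def cosh_field_def sinh_field_def)
    moreover have "p * u * (2 * sinh a)\<^sup>2 = (2 * cosh a)\<^sup>2"
      using pu(5) by (simp add: power_mult_distrib)
    ultimately have prod: "P * U * (k - l)\<^sup>2 = (k + l)\<^sup>2" by simp
    have f: "2 * cosh_b_alpha w r = P + U" by (simp add: F P_def U_def)
    have f1: "2 * cosh_b_alpha w (r - 1) = k * P + l * U"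
      by (simp add: F P_def U_def k_def l_def left_diff_distrib flip: exp_add mult.assoc)
    have "(k + l)\<^sup>2 + (P + U)\<^sup>2 + (k * P + l * U)\<^sup>2 = (k + l) * (P + U) * (k * P + l * U)"
      using kl prod by algebra
    then show ?thesis unfolding f[symmetric] f1[symmetric] 2[symmetric]
      by (simp add: power_mult_distrib)
  qed
  then show "E_alpha w r \<in> T_len"
    using gt1[of r] gt1[of "r - 1"] a by (simp add: E_alpha_def b_alpha_def T_len_def w)
qed

lemma E_alpha_0:
  assumes "w \<in> T_len"
  shows "E_alpha w 0 = w"
  using assms
  by (auto simp: E_alpha_def b_alpha_def cosh_b_alpha_def T_len_def arcosh_cosh_real algebra_simps)

text \<open>
  The function \<open>r \<mapsto> p exp (- ra) + u exp (ra)\<close> solves the linear recursion with characteristic roots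
  \<open>exp a\<close> and \<open>exp (- a)\<close>, whose step from \<open>(r, r - 1)\<close> to \<open>(r + 1, r)\<close> is the Dehn twist.
\<close>

lemma dehn_len_E_alpha:
  assumes "w \<in> T_len"
  shows "dehn_len (E_alpha w r) = E_alpha w (r + 1)"
proof -
  obtain a b c where w: "w = (a, b, c)" by (cases w)
  have a: "0 < a" using assms by (auto simp: w T_len_def)
  obtain p u where pu: "p + u = 2 * cosh b" "exp a * p + exp (- a) * u = 2 * cosh c"
    using T_len_coefficients assms unfolding w by blast
  have F: "2 * cosh_b_alpha w r = exp (- (r * a)) * p + exp (r * a) * u" for r
    unfolding w using pu a by (intro cosh_b_alpha_exp) auto
  have "2 * (2 * cosh a * cosh_b_alpha w r - cosh_b_alpha w (r - 1)) = 2 * cosh_b_alpha w (r + 1)"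
  proof -
    have k: "2 * cosh a = exp a + exp (- a)" by (simp add: cosh_field_def)
    have "2 * (2 * cosh a * cosh_b_alpha w r - cosh_b_alpha w (r - 1))
        = (2 * cosh a) * (2 * cosh_b_alpha w r) - 2 * cosh_b_alpha w (r - 1)"
      by (simp add: algebra_simps)
    also have "\<dots> = 2 * cosh_b_alpha w (r + 1)"
      unfolding F k by (simp add: algebra_simps mult_exp_exp flip: exp_add)
    finally show ?thesis .
  qed
  then show ?thesis
    using E_alpha_in_T_len(1)[OF assms, of r] E_alpha_in_T_len(1)[OF assms, of "r - 1"] a
    by (simp add: E_alpha_def b_alpha_def dehn_len_def dehn_trace_def traces_of_lengths_def
        lengths_of_traces_def w arcosh_cosh_real algebra_simps)
qed

lemma E_alpha_int:
  assumes w: "w \<in> T_len"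
  shows "E_alpha w (of_int n) = dehn_power n w"
proof -
  have pos: "(dehn_len ^^ k) w = E_alpha w (real k)" for k
    using dehn_len_E_alpha[OF w] E_alpha_0[OF w] by (induction k) (simp_all add: add.commute)
  have inv_step: "inv_into T_len dehn_len (E_alpha w r) = E_alpha w (r - 1)" for r
    using inv_into_f_f[OF bij_betw_imp_inj_on[OF bij_betw_dehn_len] E_alpha_in_T_len(2)[OF w, of "r - 1"]]
      dehn_len_E_alpha[OF w, of "r - 1"] by simp
  have neg: "(inv_into T_len dehn_len ^^ k) w = E_alpha w (- real k)" for k
  proof (induction k)
    case (Suc k)
    moreover have "- real k - 1 = - real (Suc k)" by simp
    ultimately show ?case by (simp only: funpow.simps o_apply inv_step)
  qed (simp add: E_alpha_0[OF w])
  show ?thesis by (simp add: dehn_power_def pos neg)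
qed

section \<open>Earthquakes in triangle lengths\<close>

lemma trace_coords_of_triangle_lengths:
  assumes "\<rho> \<in> teich" "triangle_lengths \<rho> = (a, b, c)"
  shows "trace_coords \<rho> = (2 * cosh a, 2 * cosh b, 2 * cosh c)"
  using assms
  by (auto simp: teich_def triangle_lengths_def trace_coords_def lengths_of_traces_def)

lemma markov_traces_T_len:
  assumes T: "(a, b, c) \<in> T_len" and SL: "fst \<rho> \<in> SL2" "snd \<rho> \<in> SL2"
    and tr: "trace_coords \<rho> = (2 * cosh a, 2 * cosh b, 2 * cosh c)"
  shows "markov_traces \<rho>" "triangle_lengths \<rho> = (a, b, c)"
proof -
  have "1 < cosh a" "1 < cosh b" "1 < cosh c"
    using T cosh_real_nonneg_less_iff[of 0] by (auto simp: T_len_def)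
  then show "markov_traces \<rho>" using T SL tr unfolding markov_traces_def trace_coords_def
    by (auto simp: T_len_def power_mult_distrib)
  show "triangle_lengths \<rho> = (a, b, c)"
    using T tr by (simp add: triangle_lengths_def lengths_of_traces_def T_len_def arcosh_cosh_real)
qed

text \<open>
  The frame is put on the imaginary axis.  The off-diagonal entries of \<open>\<rho>(\<beta>)\<close> have product
  \<open>p u - 1 = 1 / (sinh a)\<^sup>2\<close>; conjugation by dilations makes them equal, and the orientation of the
  marking makes them negative.
\<close>

lemma ex_teich_triangle_lengths:
  assumes "w \<in> T_len"
  shows "\<exists>\<rho>\<in>teich. triangle_lengths \<rho> = w"
proof -
  obtain a b c where w: "w = (a, b, c)" by (cases w)
  have a: "0 < a" using assms by (auto simp: w T_len_def)
  then have s: "0 < sinh a" by simp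
  obtain p u where pu: "0 < p" "0 < u" "p + u = 2 * cosh b" "exp a * p + exp (- a) * u = 2 * cosh c"
      "p * u * (sinh a)\<^sup>2 = (cosh a)\<^sup>2"
    using T_len_coefficients assms unfolding w by blast
  define B where "B = mk_mat2 p (- 1 / sinh a) (- 1 / sinh a) u"
  define \<rho> where "\<rho> = (translation (mat 1) (2 * a), B)"
  have "(p * u - 1) * (sinh a)\<^sup>2 = 1"
    using pu(5) cosh_square_eq[of a] by (simp add: algebra_simps)
  then have B: "B \<in> SL2" using s by (simp add: B_def SL2_iff field_simps power2_eq_square)
  have one: "matrix_inv (mat 1 :: mat2) = mat 1" by (rule matrix_inv_eqI) simp
  have "trace_coords \<rho> = (2 * cosh a, 2 * cosh b, 2 * cosh c)"
    using frame_traces[OF SL2_one B] pu(3,4) trace_translation[OF SL2_one, of "2 * a"]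
    by (simp add: trace_coords_def \<rho>_def one B_def cosh_field_def)
  then have len: "markov_traces \<rho>" "triangle_lengths \<rho> = w"
    using markov_traces_T_len[of a b c \<rho>] assms B by (simp_all add: w \<rho>_def)
  have "marking_frame \<rho> (mat 1) (2 * a)"
  proof -
    have "u * (- 1 / sinh a) + p * (- 1 / sinh a) * y\<^sup>2 < 0" for y
    proof -
      have "0 < (u + p * y\<^sup>2) / sinh a" using pu s by (simp add: add_pos_nonneg)
      then show ?thesis using s by (simp add: field_simps)
    qed
    then show ?thesis
      using left_side_iff[OF SL2_one B]
      by (simp add: marking_frame_def \<rho>_def one B_def mult.commute)
  qed
  then have "\<rho> \<in> teich"
    unfolding teich_iff_marking_frame[OF len(1)] using a
    by (intro exI[of _ "mat 1"] exI[of _ "2 * a"]) simp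
  then show ?thesis using len(2) by blast
qed

text \<open>
  Right multiplication by the dilation scales the columns of \<open>\<rho>(\<beta>)\<close> in the frame by positive factors.
  The signs of its entries and with them the orientation of the marking persist, and the traces can be
  read off.
\<close>

lemma left_earthquake_triangle_lengths:
  assumes w: "w \<in> T_len" and \<rho>: "\<rho> \<in> teich" "triangle_lengths \<rho> = w"
    and quake: "left_earthquake r \<rho> \<sigma>"
  shows "\<sigma> \<in> teich" "triangle_lengths \<sigma> = E_alpha w r"
proof -
  obtain a b c where abc: "w = (a, b, c)" by (cases w)
  have a: "0 < a" using w by (auto simp: abc T_len_def)
  have SL: "fst \<rho> \<in> SL2" "snd \<rho> \<in> SL2" using \<rho> by (auto simp: teich_def)
  have tr: "trace_coords \<rho> = (2 * cosh a, 2 * cosh b, 2 * cosh c)"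
    using trace_coords_of_triangle_lengths \<rho> by (simp add: abc)
  have markov: "markov_traces \<rho>" using markov_traces_T_len[OF w[unfolded abc] SL tr] by simp
  define d where "d = r * (2 * a)"
  have "left_twist d \<rho> \<sigma>"
    using quake \<rho>(2) by (simp add: left_earthquake_def alpha_length_def abc d_def)
  then obtain g h t where g: "marking_frame \<rho> g t" and h: "h \<in> SL2"
    and \<sigma>: "fst \<sigma> = h ** fst \<rho> ** matrix_inv h"
      "snd \<sigma> = h ** (snd \<rho> ** translation g (- d)) ** matrix_inv h"
    using left_twist_similar[OF SL] by metis
  have g': "g \<in> SL2" "fst \<rho> = translation g t" using g by (simp_all add: marking_frame_def)
  have "0 < t"
    using marking_frame_length_unique[OF markov g] teich_iff_marking_frame[OF markov] \<rho>(1) by metis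
  have t: "t = 2 * a"
  proof -
    have "2 * cosh (t / 2) = 2 * cosh a"
      using tr g' trace_translation[OF g'(1), of t] by (simp add: trace_coords_def cosh_field_def)
    then show ?thesis using \<open>0 < t\<close> a arcosh_cosh_real[of "t / 2"] arcosh_cosh_real[of a] by simp
  qed
  define M where "M = matrix_inv g ** snd \<rho> ** g"
  note signs = frame_signs[OF markov g, folded M_def]
  have M': "matrix_inv (h ** g) ** snd \<sigma> ** (h ** g) = M ** dilation (- d)"
    using g' h by (simp add: \<sigma> M_def translation_def matrix_inv_mult_SL2 flip: matrix_mul_assoc)
  have hg: "h ** g \<in> SL2" and \<sigma>SL: "fst \<sigma> \<in> SL2" "snd \<sigma> \<in> SL2" using g' h SL by (simp_all add: \<sigma>)
  have A': "fst \<sigma> = translation (h ** g) t" using g' h by (simp add: \<sigma> translation_conj)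
  note ft = frame_traces[OF g'(1) SL(2), folded M_def] frame_traces[OF hg \<sigma>SL(2), unfolded M']
  have coeff: "M$1$1 + M$2$2 = 2 * cosh b" "exp a * M$1$1 + exp (- a) * M$2$2 = 2 * cosh c"
    using tr ft(1) ft(2)[of t] by (simp_all add: trace_coords_def g'(2) t)
  have F: "2 * cosh_b_alpha w s = exp (- (s * a)) * M$1$1 + exp (s * a) * M$2$2" for s
    unfolding abc using a coeff by (intro cosh_b_alpha_exp) auto
  have "trace (fst \<sigma>) = trace (fst \<rho>)" unfolding \<sigma>(1) using h by (intro trace_similar) simp
  then have "trace (fst \<sigma>) = 2 * cosh a" using tr by (simp add: trace_coords_def)
  moreover have "trace (snd \<sigma>) = 2 * cosh_b_alpha w r"
    unfolding ft(3) F by (simp add: mat2_mult_nth d_def mult.commute)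
  moreover have "trace (fst \<sigma> ** snd \<sigma>) = 2 * cosh_b_alpha w (r - 1)"
    unfolding A' ft(4) F
    by (simp add: mat2_mult_nth d_def t left_diff_distrib exp_add exp_diff exp_minus field_simps)
  ultimately have tr': "trace_coords \<sigma> = (2 * cosh a, 2 * cosh (b_alpha w r), 2 * cosh (b_alpha w (r - 1)))"
    using E_alpha_in_T_len(1)[OF w] by (simp add: trace_coords_def b_alpha_def less_imp_le)
  have E: "E_alpha w r = (a, b_alpha w r, b_alpha w (r - 1))" by (simp add: E_alpha_def abc)
  have E_len: "(a, b_alpha w r, b_alpha w (r - 1)) \<in> T_len"
    using E_alpha_in_T_len(2)[OF w, of r] by (simp add: E)
  note markov' = markov_traces_T_len[OF E_len \<sigma>SL tr']
  have "marking_frame \<sigma> (h ** g) t"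
  proof -
    have "(M ** dilation (- d))$1$2 * (M ** dilation (- d))$2$2
        + (M ** dilation (- d))$1$1 * (M ** dilation (- d))$2$1 * y\<^sup>2 < 0" if "0 < y" for y
      using signs that by (intro add_neg_neg) (simp_all add: mat2_mult_nth mult_neg_pos mult_pos_neg)
    then show ?thesis
      using left_side_iff[OF hg \<sigma>SL(2), unfolded M'] hg A' by (simp add: marking_frame_def)
  qed
  then show "\<sigma> \<in> teich" using teich_iff_marking_frame[OF markov'(1)] \<open>0 < t\<close> by blast
  show "triangle_lengths \<sigma> = E_alpha w r"
    using markov'(2) by (simp add: E)
qed

theorem theorem3p2p2:
  fixes w :: "real \<times> real \<times> real"
  assumes "w \<in> T_len"
  shows "(\<exists>\<rho>\<in>teich. triangle_lengths \<rho> = w) \<and>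
    (\<forall>r. 1 < cosh_b_alpha w r \<and> 0 < b_alpha w r) \<and>
    (\<forall>\<rho>\<in>teich. triangle_lengths \<rho> = w \<longrightarrow>
       (\<forall>r. (\<exists>\<sigma>. left_earthquake r \<rho> \<sigma>) \<and>
            (\<forall>\<sigma>. left_earthquake r \<rho> \<sigma> \<longrightarrow>
                 \<sigma> \<in> teich \<and> triangle_lengths \<sigma> = E_alpha w r))) \<and>
    (\<forall>n :: int. E_alpha w (of_int n) = dehn_power n w)"
proof (intro conjI allI ballI impI)
  show "\<exists>\<rho>\<in>teich. triangle_lengths \<rho> = w" using assms by (rule ex_teich_triangle_lengths)
  show "1 < cosh_b_alpha w r" for r using assms by (rule E_alpha_in_T_len)
  show "0 < b_alpha w r" for r
    using E_alpha_in_T_len(1)[OF assms, of r] by (simp add: b_alpha_def)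
  show "\<exists>\<sigma>. left_earthquake r \<rho> \<sigma>" if \<rho>: "\<rho> \<in> teich" for \<rho> r
  proof -
    obtain g t where "marking_frame \<rho> g t"
      using \<rho> by (auto simp: teich_def positively_marked_def directed_axis_def marking_frame_def)
    moreover have "fst \<rho> \<in> SL2" "snd \<rho> \<in> SL2" using \<rho> by (auto simp: teich_def)
    ultimately show ?thesis using left_twist_exists unfolding left_earthquake_def by blast
  qed
  show "\<sigma> \<in> teich" "triangle_lengths \<sigma> = E_alpha w r"
    if "\<rho> \<in> teich" "triangle_lengths \<rho> = w" "left_earthquake r \<rho> \<sigma>" for \<rho> r \<sigma>
    using left_earthquake_triangle_lengths[OF assms that] by blast+
  show "E_alpha w (of_int n) = dehn_power n w" for n using assms by (rule E_alpha_int)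
qed

end
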